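(* Let $\mathcal B$ be a unital Banach algebra, $T>0$, $p\ge 1$ an integer, $L,R\in\mathcal B$ with $[L,R]=LR-RL=0$, $N:\mathcal B\times[0,T]\to\mathcal B$, and let $Q:[0,T]\to\mathcal B$ be the exact solution of $$\dot Q(t)=LQ(t)+Q(t)R+N(Q(t),t),\qquad Q(0)=Q_0 .$$ Assume that: (1) $L$ and $R$ are bounded (elements of $\mathcal B$), and $L$, $R$ and $L+R$ are infinitesimal generators of analytic semigroups $e^{tL}$, $e^{tR}$, $e^{t(L+R)}$ (so that there are constants $C'>0$, $\omega\in\mathbb R$ with $\|e^{tL}\|\le C'e^{\omega t}$ for $t\ge 0$, and similarly for $R$ and $L+R$); (2) $N$ is globally Lipschitz continuous on a strip along the exact solution, i.e. there are $\rho>0$ and $L_N\ge 0$ such that $\|N(X,t)-N(Y,t)\|\le L_N\|X-Y\|$ for all $t\in[0,T]$ and all $X,Y\in\mathcal B$ with $\|X-Q(t)\|\le\rho$, $\|Y-Q(t)\|\le\rho$; moreover the map $t\mapsto N(Q(t),t)$ is $C^p$ on $[0,T]$ and its derivatives up to order $p$ are uniformly bounded on $[0,T]$. For an integer $M\ge p$ let $h=T/M$, $t_n=nh$, and let $\{Q_n\}_{n=0}^M\subset\mathcal B$ be generated by the METD$p$ scheme defined in the context, i.e. starting values $Q_0,\dots,Q_{p-1}$ are given and $$Q_{n+1}=e^{hL}Q_ne^{hR}+I_p(Q_n,\dots,Q_{n-p+1}),\qquad p-1\le n\le M-1 .$$ Assume the starting values satisfy $$\max_{0\le n\le p-1}\|Q(t_n)-Q_n\|\le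 C_0\,h^p$$ for some constant $C_0\ge0$ (independent of $h$). Then there exist $h_0>0$ and a constant $C>0$, with $C$ independent of $h$ (for $h\le h_0$) but depending on $T$, the semigroup bounds for $e^{tL}$ and $e^{tR}$, the Lipschitz constant of $N$, and bounds on $t\mapsto N(Q(t),t)$ and its derivatives up to order $p$, such that for all such $h\le h_0$ $$\max_{0\le n\le M}\|Q(t_n)-Q_n\|\le C\,h^p .$$
   Context: A Banach algebra here is a (real or complex) Banach space $(\mathcal B,\|\cdot\|)$ with an associative unital multiplication satisfying $\|xy\|\le\|x\|\,\|y\|$; the commutator is $[x,y]=xy-yx$. The motivating case is $\mathcal B=\mathbb R^{n\times n}$ (or complex matrices). Notation for the METD$p$ scheme: - $\varphi$-functions: $\varphi_0(A)=e^A$ and $\varphi_k(A)=\int_0^1 e^{(1-\theta)A}\frac{\theta^{k-1}}{(k-1)!}\,d\theta$ for $k\ge1$, $A\in\mathcal B$. - $\mathrm{ad}_R(X)=[X,R]=XR-RX$, and $\mathrm{ad}_R^{\,j}$ denotes its $j$-fold iterate ($\mathrm{ad}_R^{\,0}(X)=X$). - For integers $m,j\ge0$, $\alpha_{m,j,q}$ ($0\le q\le m+j$) are the real numbers defined by the polynomial identity $(1-\theta)^j\binom{-\theta}{m}=\sum_{q=0}^{m+j}\alpha_{m,j,q}\theta^q$, where $\binom{-\theta}{m}=\frac{(-\theta)(-\theta-1)\cdots(-\theta-m+1)}{m!}$ (equal to $1$ for $m=0$). Set $$C_{m,j}(A)=\frac{(-1)^m}{j!}\sum_{q=0}^{m+j}\alpha_{m,j,q}\,q!\,\varphi_{q+1}(A).$$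 - For values $X_n,X_{n-1},\dots,X_{n-p+1}\in\mathcal B$ at times $t_n,\dots,t_{n-p+1}$, put $N_k=N(X_k,t_k)$ and define the backward differences $\nabla^mN_n=\sum_{\ell=0}^m(-1)^\ell\binom m\ell N_{n-\ell}$ (so $\nabla^0N_n=N_n$). The METD$p$ increment is $$I_p(X_n,\dots,X_{n-p+1})=h\sum_{m=0}^{p-1}\sum_{j=0}^{p-1-m}h^j\,C_{m,j}(A)\,\mathrm{ad}_R^{\,j}\bigl(\nabla^mN_n\bigr),\qquad A=h(L+R),$$ where $C_{m,j}(A)$ acts by left multiplication. The starting-value hypothesis holds for instance if the starting values are exact or are produced by a one-step method of order $p$. The constant $C$ is also allowed to depend on the given data $p$ and $C_0$. In the starting-value hypothesis, the numerical value at $n=0$ is allowed to differ from the exact initial datum $Q(0)$ within the stated bound.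
   Formalization: The constant C may also depend on a bound for the norm of R; without this the listed dependencies do not suffice (p=1, L=0, R=diag(ik,0), N constant E_12 gives error about Tkh/2 although e^{tR} has norm 1 for all k). *)

theory Defs
  imports "HOL-Analysis.Analysis" "HOL-Computational_Algebra.Polynomial"
begin

text \<open>
  A unital Banach algebra is a type of sort \<open>{real_normed_algebra, monoid_mult, banach}\<close>.
  The class \<open>real_normed_algebra_1\<close> is avoided because it also demands \<open>norm 1 = 1\<close>, which fails
  for instance for the Frobenius norm on matrices. A complex Banach algebra is covered by
  restricting the scalars to the reals.

  The library's exponential lives in \<open>real_normed_algebra_1\<close>; the following is the same series
  without the normalisation of the unit.
\<close>

definition bexp :: "'a::{real_normed_algebra, monoid_mult, banach} \<Rightarrow> 'a" where
  "bexp A = (\<Sum>n. A ^ n /\<^sub>R fact n)"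

lemma bexp_eq_exp: "bexp (A :: 'a::{real_normed_algebra_1, banach}) = exp A"
  by (simp add: bexp_def exp_def)


text \<open>
  Analytic semigroups need complex times. In order to treat real algebras as well, the extension
  to a sector takes values in the complexification \<open>'a \<times> 'a\<close>, where \<open>(a, b)\<close> stands for
  \<open>a + \<i> b\<close>. The semigroup acts by multiplication, so strong continuity at \<open>0\<close> is continuity of
  the representing element (apply it to the unit).
\<close>

definition cplx_mult :: "'a::real_normed_algebra \<times> 'a \<Rightarrow> 'a \<times> 'a \<Rightarrow> 'a \<times> 'a" where
  "cplx_mult x y = (fst x * fst y - snd x * snd y, fst x * snd y + snd x * fst y)"

definition cplx_scale :: "complex \<Rightarrow> 'a::real_normed_algebra \<times> 'a \<Rightarrow> 'a \<times> 'a" where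
  "cplx_scale c x = (Re c *\<^sub>R fst x - Im c *\<^sub>R snd x, Re c *\<^sub>R snd x + Im c *\<^sub>R fst x)"

text \<open>Since \<open>Arg 0 = 0\<close>, the vertex belongs to the sector.\<close>

definition sector :: "real \<Rightarrow> complex set" where
  "sector \<delta> = {z. \<bar>Arg z\<bar> < \<delta>}"

definition generates_analytic_semigroup ::
    "'a::{real_normed_algebra, monoid_mult, banach} \<Rightarrow> bool" where
  "generates_analytic_semigroup G \<longleftrightarrow>
    (\<exists>\<delta> (S :: complex \<Rightarrow> 'a \<times> 'a).
      0 < \<delta> \<and> \<delta> \<le> pi / 2 \<and>
      S 0 = (1, 0) \<and>
      (\<forall>z\<in>sector \<delta>. \<forall>w\<in>sector \<delta>. S (z + w) = cplx_mult (S z) (S w)) \<and>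
      (\<forall>z\<in>sector \<delta> - {0}. \<exists>D. (S has_derivative (\<lambda>c. cplx_scale c D)) (at z)) \<and>
      (S \<longlongrightarrow> (1, 0)) (at 0 within sector \<delta>) \<and>
      (\<forall>t\<ge>0. S (of_real t) = (bexp (t *\<^sub>R G), 0)) \<and>
      ((\<lambda>t. (S (of_real t) - (1, 0)) /\<^sub>R t) \<longlongrightarrow> (G, 0)) (at_right 0))"


definition iter_deriv_on :: "real set \<Rightarrow> nat \<Rightarrow> (real \<Rightarrow> 'a::real_normed_vector) \<Rightarrow> real \<Rightarrow> 'a" where
  "iter_deriv_on S k f = ((\<lambda>g t. vector_derivative g (at t within S)) ^^ k) f"

definition C_k_on :: "nat \<Rightarrow> (real \<Rightarrow> 'a::real_normed_vector) \<Rightarrow> real set \<Rightarrow> bool" where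
  "C_k_on k f S \<longleftrightarrow>
    (\<forall>i<k. \<forall>t\<in>S. iter_deriv_on S i f differentiable (at t within S)) \<and>
    continuous_on S (iter_deriv_on S k f)"


definition phi :: "nat \<Rightarrow> 'a::{real_normed_algebra, monoid_mult, banach} \<Rightarrow> 'a" where
  "phi k A = (if k = 0 then bexp A
     else integral {0..1} (\<lambda>\<theta>. (\<theta> ^ (k - 1) / fact (k - 1)) *\<^sub>R bexp ((1 - \<theta>) *\<^sub>R A)))"

definition alpha :: "nat \<Rightarrow> nat \<Rightarrow> nat \<Rightarrow> real" where
  "alpha m j q = coeff ([:1, -1:] ^ j * smult (1 / fact m) (\<Prod>i<m. [:- real i, -1:])) q"

lemma alpha_identity:
  "(1 - \<theta>) ^ j * ((- \<theta>) gchoose m) = (\<Sum>q\<le>m + j. alpha m j q * \<theta> ^ q)"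
proof -
  let ?P = "[:1, -1:] ^ j * smult (1 / fact m) (\<Prod>i<m. [:- real i, -1:])"
  have "degree (\<Prod>i<m. [:- real i, -1:]) \<le> (\<Sum>i<m. degree [:- real i, -1:])"
    using degree_prod_sum_le[of "{..<m}" "\<lambda>i. [:- real i, -1:]"] by (simp add: o_def)
  moreover have "degree ([:1, -1::real:] ^ j) \<le> j"
    using degree_power_le[of "[:1, -1::real:]" j] by simp
  ultimately have deg: "degree ?P \<le> m + j"
    using degree_mult_le[of "[:1, -1:] ^ j" "smult (1 / fact m) (\<Prod>i<m. [:- real i, -1:])"]
    by simp
  have "poly ?P \<theta> = (\<Sum>q\<le>m + j. coeff ?P q * \<theta> ^ q)"
    unfolding poly_altdef
    by (rule sum.mono_neutral_left) (use deg in \<open>auto simp: coeff_eq_0\<close>)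
  moreover have "poly ?P \<theta> = (1 - \<theta>) ^ j * ((- \<theta>) gchoose m)"
    by (simp add: poly_prod poly_power gbinomial_prod_rev atLeast0LessThan algebra_simps)
  ultimately show ?thesis
    by (simp add: alpha_def)
qed

definition C_coeff ::
    "nat \<Rightarrow> nat \<Rightarrow> 'a::{real_normed_algebra, monoid_mult, banach} \<Rightarrow> 'a" where
  "C_coeff m j A =
    ((-1) ^ m / fact j) *\<^sub>R (\<Sum>q\<le>m + j. (alpha m j q * fact q) *\<^sub>R phi (q + 1) A)"

definition ad :: "'a::real_normed_algebra \<Rightarrow> 'a \<Rightarrow> 'a" where
  "ad R X = X * R - R * X"

definition bdiff :: "nat \<Rightarrow> (nat \<Rightarrow> 'a::real_normed_vector) \<Rightarrow> nat \<Rightarrow> 'a" where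
  "bdiff m F n = (\<Sum>l\<le>m. ((-1) ^ l * real (m choose l)) *\<^sub>R F (n - l))"

text \<open>
  \<open>X k\<close> is the numerical value at time \<open>k * h\<close>. Only \<open>X n, \<dots>, X (n - p + 1)\<close> enter, and the
  truncated subtraction in \<open>bdiff\<close> is harmless because the scheme uses \<open>n \<ge> p - 1\<close>.
\<close>

definition metd_increment ::
    "nat \<Rightarrow> real \<Rightarrow> 'a::{real_normed_algebra, monoid_mult, banach} \<Rightarrow> 'a \<Rightarrow> ('a \<Rightarrow> real \<Rightarrow> 'a)
      \<Rightarrow> (nat \<Rightarrow> 'a) \<Rightarrow> nat \<Rightarrow> 'a" where
  "metd_increment p h L R N X n =
    h *\<^sub>R (\<Sum>m\<le>p - 1. \<Sum>j\<le>p - 1 - m.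
      h ^ j *\<^sub>R (C_coeff m j (h *\<^sub>R (L + R)) *
        (ad R ^^ j) (bdiff m (\<lambda>k. N (X k) (real k * h)) n)))"

definition metd_scheme ::
    "nat \<Rightarrow> real \<Rightarrow> nat \<Rightarrow> 'a::{real_normed_algebra, monoid_mult, banach} \<Rightarrow> 'a
      \<Rightarrow> ('a \<Rightarrow> real \<Rightarrow> 'a) \<Rightarrow> (nat \<Rightarrow> 'a) \<Rightarrow> bool" where
  "metd_scheme p h M L R N X \<longleftrightarrow>
    (\<forall>n. p - 1 \<le> n \<and> n \<le> M - 1 \<longrightarrow>
      X (n + 1) = bexp (h *\<^sub>R L) * X n * bexp (h *\<^sub>R R) + metd_increment p h L R N X n)"

end

theory Submission
  imports Defs
begin

text \<open>
  Write \<open>g t = N (Q t) t\<close> and \<open>flow t X = e\<^sup>t\<^sup>L X e\<^sup>t\<^sup>R\<close>. Variation of constants gives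
  \<open>Q (t + h) = flow h (Q t) + h \<integral>\<^sub>0\<^sup>1 flow ((1 - \<theta>) h) (g (t + \<theta> h)) d\<theta>\<close>, and the METD increment is the
  same integral after two approximations of the integrand. First, since \<open>L\<close> and \<open>R\<close> commute,
  \<open>flow \<sigma> X = e\<^bsup>\<sigma> (L + R)\<^esup> (e\<^bsup>- \<sigma> R\<^esup> X e\<^bsup>\<sigma> R\<^esup>)\<close>, and the conjugation is \<open>exp (\<sigma> ad\<^sub>R) X\<close>, whose series is
  truncated after order \<open>p - 1\<close> (\<open>flow_taylor\<close>). Secondly, in the term with \<open>ad\<^sub>R\<^sup>j\<close>, which carries the
  factor \<open>\<sigma>\<^sup>j\<close>, the function \<open>g\<close> is replaced by its Newton backward interpolant on \<open>p - j\<close> nodes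
  (\<open>newton_backward_error\<close>). Each error is \<open>O(h\<^sup>p)\<close> uniformly in \<open>\<theta>\<close>, so one step has a defect of size
  \<open>O(h\<^bsup>p + 1\<^esup>)\<close> (\<open>local_defect\<close>).

  The increment depends on the nonlinear values in a Lipschitz way with constant \<open>O(h)\<close>
  (\<open>norm_metd_op_le\<close>). Solving the error recursion by the discrete variation of constants formula
  (\<open>discrete_duhamel\<close>), rather than estimating step by step, makes \<open>flow (k h)\<close> appear instead of
  powers of its norm, so only bounds on \<open>[0, T]\<close> enter. A discrete Gronwall argument then gives
  \<open>O(h\<^sup>p)\<close> globally (\<open>global_error\<close>). The same induction shows that the numerical values stay in the
  strip where \<open>N\<close> is Lipschitz, as soon as the final bound \<open>C h\<^sup>p\<close> is at most \<open>\<rho>\<close>; this determines the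
  step size threshold.

  All estimates use \<open>L\<close> only through bounds on \<open>\<parallel>e\<^sup>t\<^sup>L\<parallel>\<close> over \<open>[0, T]\<close>, while \<open>\<parallel>R\<parallel>\<close> enters through the
  commutators. This is what makes the constant uniform in \<open>L\<close>.
\<close>


section \<open>The exponential series in a unital Banach algebra\<close>

text \<open>
  The functional equation of the exponential is obtained from the Cauchy product. The derivative
  of \<open>t \<mapsto> bexp (t A)\<close> then follows from the derivative at \<open>0\<close>, that is, from
  \<open>norm_bexp_linearization\<close>.
\<close>

definition bterm :: "'a::{real_normed_algebra, monoid_mult, banach} \<Rightarrow> nat \<Rightarrow> 'a" where
  "bterm A n = A ^ n /\<^sub>R fact n"

lemma bterm_0 [simp]: "bterm A 0 = 1"
  by (simp add: bterm_def)

lemma bterm_Suc: "real (Suc n) *\<^sub>R bterm A (Suc n) = A * bterm A n"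
proof -
  have "real (Suc n) * inverse (fact (Suc n)) = inverse (fact n :: real)"
    by (simp add: divide_simps del: of_nat_Suc)
  then show ?thesis
    unfolding bterm_def by (simp only: scaleR_scaleR power_Suc mult_scaleR_right)
qed

lemma bterm_commute: "B * A = A * B \<Longrightarrow> B * bterm A n = bterm A n * B"
  by (simp add: bterm_def power_commuting_commutes)

text \<open>The successor excludes the zeroth power, because the norm of the unit may exceed \<open>1\<close>.\<close>

lemma norm_power_Suc_le:
  fixes A :: "'a::{real_normed_algebra, monoid_mult}"
  shows "norm (A ^ Suc n) \<le> norm A ^ Suc n"
proof (induction n)
  case (Suc n)
  have "norm (A ^ Suc (Suc n)) \<le> norm A * norm (A ^ Suc n)"
    by (metis norm_mult_ineq power_Suc)
  also have "\<dots> \<le> norm A * norm A ^ Suc n"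
    by (intro mult_left_mono Suc.IH) simp
  finally show ?case by simp
qed simp

lemma norm_bterm_Suc_le: "norm (bterm A (Suc n)) \<le> norm A ^ Suc n /\<^sub>R fact (Suc n)"
proof -
  have "norm (bterm A (Suc n)) = norm (A ^ Suc n) / fact (Suc n)"
    by (simp add: bterm_def divide_inverse mult.commute del: power_Suc fact_Suc)
  also have "\<dots> \<le> norm A ^ Suc n / fact (Suc n)"
    by (intro divide_right_mono norm_power_Suc_le) simp
  finally show ?thesis by (simp add: divide_inverse mult.commute del: power_Suc fact_Suc)
qed

lemma summable_norm_bterm: "summable (\<lambda>n. norm (bterm A n))"
proof -
  have "summable (\<lambda>n. norm A ^ Suc n /\<^sub>R fact (Suc n))"
    by (subst summable_Suc_iff) (rule summable_exp_generic)
  then have "summable (\<lambda>n. norm (bterm A (Suc n)))"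
    by (rule summable_comparison_test') (use norm_bterm_Suc_le in auto)
  then show ?thesis by (subst (asm) summable_Suc_iff)
qed

lemma bexp_altdef: "bexp A = (\<Sum>n. bterm A n)"
  by (simp add: bexp_def bterm_def)

lemma bexp_0 [simp]: "bexp 0 = 1"
proof -
  have "bterm 0 n = (if n = 0 then 1 else 0 :: 'a)" for n
    by (cases n) (auto simp: bterm_def)
  then have "(\<lambda>n. bterm 0 n) sums (1::'a)"
    using sums_single[of 0 "\<lambda>_. 1::'a"] by simp
  then show ?thesis unfolding bexp_altdef by (rule sums_unique[symmetric])
qed

lemma bexp_commute:
  assumes "B * A = A * B"
  shows "B * bexp A = bexp A * B"
proof -
  have s: "summable (bterm A)" by (rule summable_norm_cancel[OF summable_norm_bterm])
  have "B * bexp A = (\<Sum>n. B * bterm A n)"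
    unfolding bexp_altdef by (rule suminf_mult[OF s, symmetric])
  also have "\<dots> = (\<Sum>n. bterm A n * B)" by (simp add: bterm_commute[OF assms])
  also have "\<dots> = bexp A * B" unfolding bexp_altdef by (rule suminf_mult2[OF s, symmetric])
  finally show ?thesis .
qed

text \<open>
  With \<open>c n\<close> for the left-hand side, splitting \<open>n + 1 = i + (n + 1 - i)\<close> in each summand yields
  \<open>(n + 1) c (n + 1) = (A + B) c n\<close>, which is the recursion \<open>bterm_Suc\<close> of the right-hand side.
\<close>

lemma bterm_convolution:
  assumes comm: "A * B = B * A"
  shows "(\<Sum>i\<le>n. bterm A i * bterm B (n - i)) = bterm (A + B) n"
proof (induction n)
  case (Suc n)
  let ?c = "\<lambda>n. \<Sum>i\<le>n. bterm A i * bterm B (n - i)"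
  have "real (Suc n) *\<^sub>R ?c (Suc n) =
      (\<Sum>i\<le>Suc n. real i *\<^sub>R (bterm A i * bterm B (Suc n - i))) +
      (\<Sum>i\<le>Suc n. real (Suc n - i) *\<^sub>R (bterm A i * bterm B (Suc n - i)))"
    unfolding sum.distrib[symmetric] scaleR_sum_right
    by (intro sum.cong refl, subst scaleR_left_distrib[symmetric])
      (simp add: of_nat_diff)
  also have "(\<Sum>i\<le>Suc n. real i *\<^sub>R (bterm A i * bterm B (Suc n - i))) = A * ?c n"
    by (subst sum.atMost_Suc_shift)
      (simp add: sum_distrib_left mult.assoc[symmetric] bterm_Suc[symmetric] del: of_nat_Suc)
  also have "(\<Sum>i\<le>Suc n. real (Suc n - i) *\<^sub>R (bterm A i * bterm B (Suc n - i))) = B * ?c n"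
  proof -
    have "real (Suc n - i) *\<^sub>R (bterm A i * bterm B (Suc n - i)) =
        B * (bterm A i * bterm B (n - i))" if "i \<le> n" for i
    proof -
      have "real (Suc n - i) *\<^sub>R (bterm A i * bterm B (Suc n - i)) =
          bterm A i * (real (Suc (n - i)) *\<^sub>R bterm B (Suc (n - i)))"
        using that by (simp add: Suc_diff_le)
      also have "\<dots> = bterm A i * B * bterm B (n - i)"
        by (simp only: bterm_Suc mult.assoc)
      also have "\<dots> = B * (bterm A i * bterm B (n - i))"
        by (simp only: bterm_commute[OF comm[symmetric], symmetric] mult.assoc)
      finally show ?thesis .
    qed
    then show ?thesis by (simp add: sum_distrib_left)
  qed
  also have "A * ?c n + B * ?c n = real (Suc n) *\<^sub>R bterm (A + B) (Suc n)"
    by (simp only: Suc.IH bterm_Suc distrib_right)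
  finally show ?case by (simp del: of_nat_Suc sum.atMost_Suc)
qed simp

lemma bexp_add_commuting:
  assumes "A * B = B * A"
  shows "bexp (A + B) = bexp A * bexp B"
  unfolding bexp_altdef
  by (simp add: Cauchy_product summable_norm_bterm bterm_convolution[OF assms])

lemma bexp_add_scaleR: "bexp ((s + t) *\<^sub>R A) = bexp (s *\<^sub>R A) * bexp (t *\<^sub>R A)"
  by (simp add: scaleR_left_distrib bexp_add_commuting)

lemma bexp_scaleR_commute:
  assumes "B * A = A * B"
  shows "B * bexp (t *\<^sub>R A) = bexp (t *\<^sub>R A) * B"
  by (rule bexp_commute) (simp add: assms)

lemma norm_bexp_linearization:
  fixes A :: "'a::{real_normed_algebra, monoid_mult, banach}"
  shows "norm (bexp A - 1 - A) \<le> (norm A)\<^sup>2 * exp (norm A)"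
proof -
  let ?g = "\<lambda>n. (norm A)\<^sup>2 * (norm A ^ n /\<^sub>R fact n)"
  have g: "?g sums ((norm A)\<^sup>2 * exp (norm A))"
    by (intro sums_mult exp_converges)
  have le: "norm (bterm A (n + 2)) \<le> ?g n" for n
  proof -
    have "norm (bterm A (n + 2)) \<le> norm A ^ (n + 2) / fact (n + 2)"
      using norm_bterm_Suc_le[of A "Suc n"] by (simp add: divide_inverse mult.commute)
    also have "\<dots> \<le> norm A ^ (n + 2) / fact n"
      by (intro divide_left_mono fact_mono) auto
    finally show ?thesis by (simp add: power_add power2_eq_square divide_inverse mult_ac)
  qed
  have s: "summable (bterm A)" by (rule summable_norm_cancel[OF summable_norm_bterm])
  have b1: "bterm A (Suc 0) = A" by (simp add: bterm_def)
  have "bexp A - 1 - A = (\<Sum>n. bterm A (n + 2))"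
    using suminf_split_initial_segment[OF s, of 2] b1
    by (simp add: bexp_altdef numeral_2_eq_2)
  also have "norm \<dots> \<le> (\<Sum>n. norm (bterm A (n + 2)))"
    by (rule summable_norm) (rule summable_ignore_initial_segment[OF summable_norm_bterm])
  also have "\<dots> \<le> (\<Sum>n. ?g n)"
    by (intro suminf_le le summable_ignore_initial_segment summable_norm_bterm
        sums_summable[OF g])
  finally show ?thesis using g by (simp add: sums_iff)
qed

lemma bexp_scaleR_has_vector_derivative_at:
  "((\<lambda>t. bexp (t *\<^sub>R A)) has_vector_derivative A * bexp (t *\<^sub>R A)) (at t)"
proof -
  let ?E = "bexp (t *\<^sub>R A)"
  have "(\<lambda>d. norm (bexp ((t + d) *\<^sub>R A) - ?E - d *\<^sub>R (A * ?E)) / norm d) \<midarrow>0\<rightarrow> 0"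
  proof (rule tendsto_0_le[where K = 1])
    show "(\<lambda>d. \<bar>d\<bar> * ((norm A)\<^sup>2 * exp (\<bar>d\<bar> * norm A) * norm ?E)) \<midarrow>0\<rightarrow> 0"
      by (rule tendsto_eq_intros refl | simp)+
    show "\<forall>\<^sub>F d in at 0. norm (norm (bexp ((t + d) *\<^sub>R A) - ?E - d *\<^sub>R (A * ?E)) / norm d)
        \<le> norm (\<bar>d\<bar> * ((norm A)\<^sup>2 * exp (\<bar>d\<bar> * norm A) * norm ?E)) * 1"
    proof (rule always_eventually, rule allI)
      fix d :: real
      have "bexp ((t + d) *\<^sub>R A) - ?E - d *\<^sub>R (A * ?E) = (bexp (d *\<^sub>R A) - 1 - d *\<^sub>R A) * ?E"
        by (subst add.commute, subst bexp_add_scaleR) (simp add: algebra_simps)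
      also have "norm \<dots> \<le> norm (bexp (d *\<^sub>R A) - 1 - d *\<^sub>R A) * norm ?E"
        by (rule norm_mult_ineq)
      also have "\<dots> \<le> (norm (d *\<^sub>R A))\<^sup>2 * exp (norm (d *\<^sub>R A)) * norm ?E"
        by (intro mult_right_mono norm_bexp_linearization) simp
      finally show "norm (norm (bexp ((t + d) *\<^sub>R A) - ?E - d *\<^sub>R (A * ?E)) / norm d)
        \<le> norm (\<bar>d\<bar> * ((norm A)\<^sup>2 * exp (\<bar>d\<bar> * norm A) * norm ?E)) * 1"
        by (cases "d = 0") (simp_all add: abs_mult power2_eq_square field_simps)
    qed
  qed
  then show ?thesis
    unfolding has_vector_derivative_def has_derivative_at
    by (simp add: bounded_linear_scaleR_left)
qed

lemma bexp_scaleR_has_vector_derivative [derivative_intros]: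
  fixes c :: "real \<Rightarrow> real"
  assumes "(c has_vector_derivative c') (at t within S)"
  shows "((\<lambda>t. bexp (c t *\<^sub>R A)) has_vector_derivative c' *\<^sub>R (A * bexp (c t *\<^sub>R A)))
    (at t within S)"
  using vector_diff_chain_within[OF assms
      has_vector_derivative_at_within[OF bexp_scaleR_has_vector_derivative_at[of A "c t"]]]
  by (simp add: o_def)

lemma continuous_on_bexp_scaleR [continuous_intros]:
  fixes c :: "real \<Rightarrow> real"
  assumes "continuous_on S c"
  shows "continuous_on S (\<lambda>t. bexp (c t *\<^sub>R A))"
proof -
  have "continuous_on UNIV (\<lambda>t. bexp (t *\<^sub>R A))"
    by (intro continuous_at_imp_continuous_on ballI
        has_vector_derivative_continuous[OF bexp_scaleR_has_vector_derivative_at])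
  then show ?thesis
    by (rule continuous_on_compose2[OF _ assms]) simp
qed

section \<open>Newton backward interpolation with remainder\<close>

text \<open>
  Backward differences at a fixed index are binomial transforms of the sequence read backwards.
  The transform is an involution, which is the discrete form of Newton's interpolation formula.
\<close>

definition binomial_transform :: "nat \<Rightarrow> (nat \<Rightarrow> 'a::real_vector) \<Rightarrow> 'a" where
  "binomial_transform m a = (\<Sum>l\<le>m. ((-1) ^ l * real (m choose l)) *\<^sub>R a l)"

lemma bdiff_eq_binomial_transform: "bdiff m F n = binomial_transform m (\<lambda>l. F (n - l))"
  by (simp add: bdiff_def binomial_transform_def)

lemma binomial_transform_Suc:
  "binomial_transform (Suc m) a = binomial_transform m (\<lambda>l. a l - a (Suc l))"
proof -
  let ?c = "\<lambda>m l. (-1) ^ l * real (m choose l)"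
  have "binomial_transform (Suc m) a
      = a 0 + (\<Sum>l\<le>m. (?c m (Suc l) - ?c m l) *\<^sub>R a (Suc l))"
    unfolding binomial_transform_def
    by (subst sum.atMost_Suc_shift)
      (simp add: distrib_left scaleR_left_diff_distrib scaleR_left_distrib
        sum.distrib sum_subtractf sum_negf)
  also have "\<dots> = (a 0 + (\<Sum>l\<le>m. ?c m (Suc l) *\<^sub>R a (Suc l))) - (\<Sum>l\<le>m. ?c m l *\<^sub>R a (Suc l))"
    by (simp add: scaleR_left_diff_distrib sum_subtractf)
  also have "a 0 + (\<Sum>l\<le>m. ?c m (Suc l) *\<^sub>R a (Suc l)) = (\<Sum>l\<le>Suc m. ?c m l *\<^sub>R a l)"
    by (subst sum.atMost_Suc_shift) simp
  also have "\<dots> = (\<Sum>l\<le>m. ?c m l *\<^sub>R a l)"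
    by (simp add: binomial_eq_0)
  finally show ?thesis
    by (simp add: binomial_transform_def scaleR_right_diff_distrib sum_subtractf)
qed

lemma binomial_transform_diff:
  "binomial_transform m (\<lambda>l. a l - b l) = binomial_transform m a - binomial_transform m b"
  by (simp add: binomial_transform_def scaleR_right_diff_distrib sum_subtractf)

lemma binomial_transform_sum:
  "binomial_transform m (\<lambda>l. \<Sum>i\<in>I. a i l) = (\<Sum>i\<in>I. binomial_transform m (a i))"
  unfolding binomial_transform_def scaleR_sum_right by (rule sum.swap)

lemma binomial_transform_scaleR_left:
  "binomial_transform m (\<lambda>l. c l *\<^sub>R v) = binomial_transform m c *\<^sub>R v"
  by (simp add: binomial_transform_def scaleR_sum_left)

text \<open>
  Shifting the sequence by one corresponds to \<open>1 - \<nabla>\<close> by \<open>binomial_transform_Suc\<close>; the same lemma,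
  used for the outer transform, then reduces the claim at \<open>s + 1\<close> to the shifted sequence at \<open>s\<close>.
\<close>

lemma binomial_inversion: "binomial_transform s (\<lambda>m. binomial_transform m a) = a s"
proof (induction s arbitrary: a)
  case 0
  then show ?case by (simp add: binomial_transform_def)
next
  case (Suc s)
  have "binomial_transform (Suc s) (\<lambda>m. binomial_transform m a) =
      binomial_transform s (\<lambda>m. binomial_transform m (\<lambda>l. a (Suc l)))"
    by (simp add: binomial_transform_Suc binomial_transform_diff)
  then show ?case by (simp add: Suc.IH)
qed

lemma norm_binomial_transform_le:
  fixes a :: "nat \<Rightarrow> 'a::real_normed_vector"
  assumes "\<And>l. l \<le> m \<Longrightarrow> norm (a l) \<le> B"
  shows "norm (binomial_transform m a) \<le> 2 ^ m * B"
proof -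
  have "norm (binomial_transform m a) \<le> (\<Sum>l\<le>m. real (m choose l) * B)"
    unfolding binomial_transform_def
    by (rule sum_norm_le) (auto simp: abs_mult intro!: mult_left_mono assms)
  also have "\<dots> = real (\<Sum>l\<le>m. m choose l) * B"
    by (simp add: sum_distrib_right)
  finally show ?thesis by (simp add: choose_row_sum)
qed

text \<open>
  The basis polynomials of Newton's backward formula. They are \<open>(-1)\<^sup>m\<close> times the generalized binomial
  coefficient of \<open>- \<theta>\<close>; as rising factorials they visibly lie in \<open>[0, 1]\<close> for \<open>\<theta> \<in> [0, 1]\<close>.
\<close>

definition newton_weight :: "nat \<Rightarrow> real \<Rightarrow> real" where
  "newton_weight m \<theta> = pochhammer \<theta> m / fact m"

lemma newton_weight_gbinomial: "newton_weight m \<theta> = (-1) ^ m * (- \<theta> gchoose m)"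
  by (simp add: newton_weight_def gbinomial_pochhammer mult.assoc[symmetric] power_mult_distrib[symmetric])

lemma newton_weight_at_node: "newton_weight m (- real s) = (-1) ^ m * real (s choose m)"
  by (simp add: newton_weight_gbinomial binomial_gbinomial)

lemma newton_weight_bounds:
  assumes "\<theta> \<in> {0..1}"
  shows "0 \<le> newton_weight m \<theta>" "newton_weight m \<theta> \<le> 1"
proof -
  show "0 \<le> newton_weight m \<theta>"
    unfolding newton_weight_def pochhammer_prod
    using assms by (intro divide_nonneg_nonneg prod_nonneg) auto
  have "pochhammer \<theta> m \<le> pochhammer 1 m"
    unfolding pochhammer_prod using assms by (intro prod_mono) auto
  then show "newton_weight m \<theta> \<le> 1"
    by (simp add: newton_weight_def pochhammer_fact[symmetric])
qed

text \<open>
  Both sides are polynomials of degree below \<open>k\<close>, and at the nodes \<open>0, -1, \<dots>, -(k - 1)\<close> they agree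
  because there the weights are signed binomial coefficients and \<open>binomial_inversion\<close> applies.
\<close>

lemma newton_backward_poly:
  fixes q :: "real poly"
  assumes deg: "degree q < k"
  shows "poly q \<theta> =
    (\<Sum>m<k. newton_weight m \<theta> * binomial_transform m (\<lambda>l. poly q (- real l)))"
proof -
  define W :: "nat \<Rightarrow> real poly" where "W m = smult (1 / fact m) (\<Prod>i<m. [:real i, 1:])" for m
  have poly_W: "poly (W m) x = newton_weight m x" for m x
    by (simp add: W_def newton_weight_def poly_prod pochhammer_prod atLeast0LessThan add.commute)
  have deg_W: "degree (W m) < k" if "m < k" for m
  proof -
    have "degree (\<Prod>i<m. [:real i, 1:]) \<le> (\<Sum>i<m. degree [:real i, 1:])"
      using degree_prod_sum_le[of "{..<m}" "\<lambda>i. [:real i, 1:]"] by (simp add: o_def)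
    then show ?thesis using that by (simp add: W_def)
  qed
  define P where "P = (\<Sum>m<k. smult (binomial_transform m (\<lambda>l. poly q (- real l))) (W m))"
  have poly_P: "poly P x =
      (\<Sum>m<k. newton_weight m x * binomial_transform m (\<lambda>l. poly q (- real l)))" for x
    by (simp add: P_def poly_sum poly_W mult.commute)
  have "q = P"
  proof (rule poly_eqI_degree)
    show "poly q x = poly P x" if "x \<in> (\<lambda>s. - real s) ` {..<k}" for x
    proof -
      from that obtain s where s: "s < k" "x = - real s" by auto
      have "poly P x = (\<Sum>m<k. (-1) ^ m * real (s choose m) *
          binomial_transform m (\<lambda>l. poly q (- real l)))"
        by (simp add: poly_P s newton_weight_at_node)
      also have "\<dots> = (\<Sum>m\<le>s. (-1) ^ m * real (s choose m) *
          binomial_transform m (\<lambda>l. poly q (- real l)))"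
        by (rule sum.mono_neutral_right) (use s in auto)
      also have "\<dots> = poly q x"
        using binomial_inversion[of s "\<lambda>l. poly q (- real l)"]
        by (subst (asm) (1) binomial_transform_def) (simp add: s)
      finally show ?thesis by simp
    qed
    have card: "card ((\<lambda>s. - real s) ` {..<k}) = k"
      by (subst card_image) (auto simp: inj_on_def)
    show "degree q < card ((\<lambda>s. - real s) ` {..<k})" by (simp add: card deg)
    have "degree P < k"
      unfolding P_def using deg deg_W
      by (intro degree_sum_less) (auto intro: le_less_trans[OF degree_smult_le])
    then show "degree P < card ((\<lambda>s. - real s) ` {..<k})" by (simp add: card)
  qed
  then show ?thesis using poly_P[of \<theta>] by simp
qed

lemma norm_has_integral_Icc_le:
  fixes f :: "real \<Rightarrow> 'a::real_normed_vector"
  assumes int: "(f has_integral i) {a..b}" and le: "a \<le> b"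
    and B: "\<And>x. x \<in> {a..b} \<Longrightarrow> norm (f x) \<le> B"
  shows "norm i \<le> B * (b - a)"
proof -
  have "norm (f a) \<le> B" by (rule B) (use le in simp)
  with norm_ge_zero have "0 \<le> B" by (rule order_trans)
  from has_integral_bound_real[OF this finite.emptyI int] show ?thesis
    using le B by simp
qed

text \<open>
  Interpolation is exact on the Taylor polynomial, so only the Taylor remainder contributes, at the
  evaluation point and at the nodes. The expansion is taken at the leftmost node, so that all these
  points lie to its right, within distance \<open>k h\<close>.
\<close>

lemma newton_backward_error:
  fixes g :: "real \<Rightarrow> 'a::banach" and Dg :: "nat \<Rightarrow> real \<Rightarrow> 'a"
  assumes k: "k > 0" and h: "h > 0" and \<theta>: "\<theta> \<in> {0..1}"
    and J: "J = {c - real (k - 1) * h..c + h}"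
    and Dg_0: "Dg 0 = g"
    and Dg: "\<And>i t. i < k \<Longrightarrow> t \<in> J \<Longrightarrow> (Dg i has_vector_derivative Dg (Suc i) t) (at t within J)"
    and K: "\<And>t. t \<in> J \<Longrightarrow> norm (Dg k t) \<le> K"
  shows "norm (g (c + \<theta> * h) -
      (\<Sum>m<k. newton_weight m \<theta> *\<^sub>R binomial_transform m (\<lambda>l. g (c - real l * h))))
    \<le> (1 + 2 ^ k) * (K * (real k * h) ^ k)"
proof -
  define a where "a = c - real (k - 1) * h"
  have J_a: "J = {a..c + h}" by (simp add: J a_def)
  have len: "c + h - a = real k * h"
    using k by (simp add: a_def of_nat_diff algebra_simps)
  have "0 \<le> real k * h" using h by simp
  then have a_mem: "a \<in> J" unfolding J_a using len by simp
  have K0: "K \<ge> 0" using K[OF a_mem] norm_ge_zero order_trans by blast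
  define P where "P x = (\<Sum>i<k. ((x - a) ^ i / fact i) *\<^sub>R Dg i a)" for x
  define E where "E x = g x - P x" for x
  have norm_E: "norm (E x) \<le> K * (real k * h) ^ k" if x: "x \<in> J" for x
  proof -
    let ?i = "\<lambda>t. ((x - t) ^ (k - 1) / fact (k - 1)) *\<^sub>R Dg k t"
    have sub: "{a..x} \<subseteq> J" using x by (auto simp: J_a)
    have ax: "a \<le> x" "x - a \<le> real k * h" using x len by (auto simp: J_a)
    have "(?i has_integral g x - P x) {a..x}"
      unfolding P_def
    proof (rule Taylor_has_integral[where Df = Dg, OF k Dg_0 _ ax(1)])
      show "(Dg i has_vector_derivative Dg (Suc i) t) (at t within {a..x})"
        if "i < k" "a \<le> t" "t \<le> x" for i t
        by (rule has_vector_derivative_within_subset[OF Dg[OF that(1)] sub]) (use that sub in auto)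
    qed
    then have "norm (g x - P x) \<le> ((real k * h) ^ (k - 1) * K) * (x - a)"
    proof (rule norm_has_integral_Icc_le)
      show "norm (?i t) \<le> (real k * h) ^ (k - 1) * K" if t: "t \<in> {a..x}" for t
      proof -
        have "(x - t) ^ (k - 1) / fact (k - 1) \<le> (real k * h) ^ (k - 1) / 1"
          using t ax by (intro frac_le power_mono fact_ge_1) auto
        moreover have "norm (Dg k t) \<le> K" using t sub by (intro K) auto
        ultimately have "(x - t) ^ (k - 1) / fact (k - 1) * norm (Dg k t) \<le> (real k * h) ^ (k - 1) / 1 * K"
          using h by (intro mult_mono) auto
        then show ?thesis using t by simp
      qed
    qed (rule ax(1))
    then have "norm (E x) \<le> ((real k * h) ^ (k - 1) * K) * (x - a)"
      by (simp add: E_def)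
    also have "\<dots> \<le> ((real k * h) ^ (k - 1) * K) * (real k * h)"
      using ax K0 h by (intro mult_left_mono) auto
    also have "\<dots> = K * (real k * h) ^ k"
      using k by (cases k) (auto simp: mult_ac)
    finally show ?thesis .
  qed
  let ?I = "\<lambda>f. (\<Sum>m<k. newton_weight m \<theta> *\<^sub>R binomial_transform m (\<lambda>l. f (c - real l * h)))"
  have I_P: "?I P = P (c + \<theta> * h)"
  proof -
    \<comment> \<open>in the variable \<open>\<theta>\<close> the monomial centred at \<open>a\<close> is a polynomial, and the node \<open>c - l h\<close> is \<open>\<theta> = - l\<close>\<close>
    have poly_i: "(\<Sum>m<k. newton_weight m \<theta> *
        binomial_transform m (\<lambda>l. (c - real l * h - a) ^ i)) = (c + \<theta> * h - a) ^ i"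
      if "i < k" for i
    proof -
      let ?q = "[:c - a, h:] ^ i"
      have "degree ?q \<le> i" using degree_power_le[of "[:c - a, h:]" i] h by simp
      then have "degree ?q < k" using that by simp
      from newton_backward_poly[OF this, of \<theta>] show ?thesis
        by (simp add: poly_power algebra_simps)
    qed
    have "?I P = (\<Sum>m<k. \<Sum>i<k. (newton_weight m \<theta> *
        binomial_transform m (\<lambda>l. (c - real l * h - a) ^ i) / fact i) *\<^sub>R Dg i a)"
      unfolding P_def binomial_transform_sum
      by (simp add: binomial_transform_scaleR_left divide_inverse
        binomial_transform_def scaleR_sum_right sum_distrib_right sum_distrib_left mult_ac)
    also have "\<dots> = (\<Sum>i<k. ((\<Sum>m<k. newton_weight m \<theta> *
        binomial_transform m (\<lambda>l. (c - real l * h - a) ^ i)) / fact i) *\<^sub>R Dg i a)"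
      by (subst sum.swap) (simp add: scaleR_sum_left sum_divide_distrib)
    also have "\<dots> = P (c + \<theta> * h)" by (simp add: poly_i P_def)
    finally show ?thesis .
  qed
  let ?\<epsilon> = "K * (real k * h) ^ k"
  have "g (c + \<theta> * h) - ?I g = E (c + \<theta> * h) - ?I E"
    by (simp add: E_def binomial_transform_diff scaleR_right_diff_distrib sum_subtractf I_P)
  also have "norm \<dots> \<le> ?\<epsilon> + (\<Sum>m<k. 2 ^ m * ?\<epsilon>)"
  proof (rule norm_triangle_le_diff, rule add_mono)
    show "norm (E (c + \<theta> * h)) \<le> ?\<epsilon>"
    proof (rule norm_E)
      have "0 \<le> \<theta> * h" "\<theta> * h \<le> 1 * h" "0 \<le> real (k - 1) * h"
        using \<theta> h by (auto intro: mult_right_mono)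
      then show "c + \<theta> * h \<in> J" unfolding J atLeastAtMost_iff by linarith
    qed
    show "norm (?I E) \<le> (\<Sum>m<k. 2 ^ m * ?\<epsilon>)"
    proof (rule sum_norm_le)
      fix m assume m: "m \<in> {..<k}"
      have "norm (binomial_transform m (\<lambda>l. E (c - real l * h))) \<le> 2 ^ m * ?\<epsilon>"
      proof (rule norm_binomial_transform_le, rule norm_E)
        fix l assume "l \<le> m"
        with m have "real l \<le> real (k - 1)" by simp
        then have "real l * h \<le> real (k - 1) * h" "0 \<le> real l * h"
          using h by (auto intro: mult_right_mono)
        then show "c - real l * h \<in> J" unfolding J atLeastAtMost_iff using h by linarith
      qed
      then have "newton_weight m \<theta> * norm (binomial_transform m (\<lambda>l. E (c - real l * h)))
          \<le> 1 * (2 ^ m * ?\<epsilon>)"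
        using newton_weight_bounds[OF \<theta>] by (intro mult_mono) auto
      then show "norm (newton_weight m \<theta> *\<^sub>R binomial_transform m (\<lambda>l. E (c - real l * h)))
          \<le> 2 ^ m * ?\<epsilon>"
        using newton_weight_bounds[OF \<theta>, of m] by simp
    qed
  qed
  also have "\<dots> \<le> (1 + 2 ^ k) * ?\<epsilon>"
  proof -
    have "(\<Sum>m<k. 2 ^ m) \<le> (2 ^ k :: real)"
      by (subst sum_gp_strict) simp
    then have "(\<Sum>m<k. 2 ^ m) * ?\<epsilon> \<le> 2 ^ k * ?\<epsilon>"
      using K0 h by (intro mult_right_mono) auto
    then show ?thesis unfolding sum_distrib_right distrib_right by simp
  qed
  finally show ?thesis .
qed

section \<open>Commuting semigroups and iterated commutators\<close>

lemma linear_ad_power: "linear (ad R ^^ j)"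
proof (induction j)
  case 0
  then show ?case by (simp add: linear_id[unfolded id_def] id_def)
next
  case (Suc j)
  have "linear (ad R)"
    by (intro linearI) (simp_all add: ad_def algebra_simps)
  from linear_compose[OF Suc.IH this] show ?case by (simp add: o_def)
qed

lemma norm_ad_power_le:
  assumes "norm R \<le> r"
  shows "norm ((ad R ^^ j) X) \<le> (2 * r) ^ j * norm X"
proof (induction j)
  case (Suc j)
  let ?Y = "(ad R ^^ j) X"
  have r: "0 \<le> r" using assms norm_ge_zero order_trans by blast
  have "norm (ad R ?Y) \<le> norm (?Y * R) + norm (R * ?Y)"
    unfolding ad_def by (rule norm_triangle_ineq4)
  also have "\<dots> \<le> norm ?Y * norm R + norm R * norm ?Y"
    by (intro add_mono norm_mult_ineq)
  also have "\<dots> = 2 * norm R * norm ?Y" by simp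
  also have "\<dots> \<le> 2 * r * ((2 * r) ^ j * norm X)"
    using assms r by (intro mult_mono Suc.IH) auto
  finally show ?case by (simp add: mult_ac)
qed simp

text \<open>
  Up to the sign \<open>(-1)\<^sup>m\<close>, the numbers \<open>alpha m j q\<close> are the monomial coefficients of
  \<open>(1 - \<theta>)\<^sup>j newton_weight m \<theta>\<close>, and \<open>fact q *\<^sub>R phi (q + 1) A\<close> is the integral of the monomial \<open>\<theta>\<^sup>q\<close>
  against the exponential.
\<close>

lemma C_coeff_has_integral:
  "((\<lambda>\<theta>. ((1 - \<theta>) ^ j / fact j * newton_weight m \<theta>) *\<^sub>R bexp ((1 - \<theta>) *\<^sub>R A))
    has_integral C_coeff m j A) {0..1}"
proof -
  have phi: "((\<lambda>\<theta>. (\<theta> ^ q / fact q) *\<^sub>R bexp ((1 - \<theta>) *\<^sub>R A)) has_integral phi (q + 1) A) {0..1}" for q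
    unfolding phi_def by simp
      (intro integrable_integral integrable_continuous_real continuous_intros; simp)
  have "((\<lambda>\<theta>. ((-1) ^ m / fact j) *\<^sub>R (\<Sum>q\<le>m + j. (alpha m j q * fact q) *\<^sub>R
      ((\<theta> ^ q / fact q) *\<^sub>R bexp ((1 - \<theta>) *\<^sub>R A)))) has_integral C_coeff m j A) {0..1}"
    unfolding C_coeff_def by (intro has_integral_cmul has_integral_sum phi) simp
  moreover have "((-1) ^ m / fact j) *\<^sub>R (\<Sum>q\<le>m + j. (alpha m j q * fact q) *\<^sub>R
        ((\<theta> ^ q / fact q) *\<^sub>R bexp ((1 - \<theta>) *\<^sub>R A)))
      = ((1 - \<theta>) ^ j / fact j * newton_weight m \<theta>) *\<^sub>R bexp ((1 - \<theta>) *\<^sub>R A)" for \<theta>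
  proof -
    have "(\<Sum>q\<le>m + j. (alpha m j q * fact q) *\<^sub>R ((\<theta> ^ q / fact q) *\<^sub>R bexp ((1 - \<theta>) *\<^sub>R A)))
        = (\<Sum>q\<le>m + j. alpha m j q * \<theta> ^ q) *\<^sub>R bexp ((1 - \<theta>) *\<^sub>R A)"
      by (simp add: scaleR_sum_left)
    then show ?thesis
      by (simp add: alpha_identity[symmetric] newton_weight_gbinomial)
  qed
  ultimately show ?thesis by simp
qed

text \<open>
  The constants below depend on \<open>L\<close> and \<open>R\<close> only through \<open>b\<^sub>L\<close>, \<open>b\<^sub>R\<close> and \<open>r\<close>, and are therefore uniform
  over all pairs with these bounds.
\<close>

locale commuting_semigroups =
  fixes L R :: "'a::{real_normed_algebra, monoid_mult, banach}" and T b\<^sub>L b\<^sub>R r :: real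
  assumes commute: "L * R = R * L"
    and norm_bexp_L: "t \<in> {0..T} \<Longrightarrow> norm (bexp (t *\<^sub>R L)) \<le> b\<^sub>L"
    and norm_bexp_R: "t \<in> {0..T} \<Longrightarrow> norm (bexp (t *\<^sub>R R)) \<le> b\<^sub>R"
    and norm_R: "norm R \<le> r"
    and T_pos: "T > 0"
begin

lemma bounds_nonneg: "0 \<le> b\<^sub>L" "0 \<le> b\<^sub>R" "0 \<le> r"
  using norm_bexp_L[of 0] norm_bexp_R[of 0] norm_R T_pos
  by (auto intro: order_trans[OF norm_ge_zero])

lemma bexp_scaleR_add: "bexp (t *\<^sub>R (L + R)) = bexp (t *\<^sub>R L) * bexp (t *\<^sub>R R)"
  using commute by (simp add: scaleR_right_distrib bexp_add_commuting)

lemma norm_bexp_add_le: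
  assumes "t \<in> {0..T}"
  shows "norm (bexp (t *\<^sub>R (L + R))) \<le> b\<^sub>L * b\<^sub>R"
  unfolding bexp_scaleR_add
  by (rule order_trans[OF norm_mult_ineq])
    (intro mult_mono norm_bexp_L norm_bexp_R assms bounds_nonneg norm_ge_zero)

definition flow :: "real \<Rightarrow> 'a \<Rightarrow> 'a" where
  "flow t X = bexp (t *\<^sub>R L) * X * bexp (t *\<^sub>R R)"

lemma flow_0 [simp]: "flow 0 X = X"
  by (simp add: flow_def)

lemma flow_flow: "flow s (flow t X) = flow (s + t) X"
proof -
  have "bexp (t *\<^sub>R R) * bexp (s *\<^sub>R R) = bexp ((s + t) *\<^sub>R R)"
    by (simp add: bexp_add_scaleR[symmetric] add.commute)
  then show ?thesis
    by (simp add: flow_def bexp_add_scaleR[of s t L] mult.assoc)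
qed

lemma linear_flow: "linear (flow t)"
  by (intro linearI) (simp_all add: flow_def algebra_simps)

lemma norm_flow_le:
  assumes "t \<in> {0..T}"
  shows "norm (flow t X) \<le> b\<^sub>L * b\<^sub>R * norm X"
proof -
  have "norm (flow t X) \<le> norm (bexp (t *\<^sub>R L)) * norm X * norm (bexp (t *\<^sub>R R))"
    unfolding flow_def
    by (rule order_trans[OF norm_mult_ineq]) (intro mult_right_mono norm_mult_ineq norm_ge_zero)
  also have "\<dots> \<le> b\<^sub>L * norm X * b\<^sub>R"
    by (intro mult_mono norm_bexp_L norm_bexp_R assms) (auto simp: bounds_nonneg)
  finally show ?thesis by (simp add: mult_ac)
qed

text \<open>
  The curve \<open>V s = e\<^bsup>\<sigma> L\<^esup> e\<^bsup>(\<sigma> - s) R\<^esup> X e\<^bsup>s R\<^esup>\<close> runs from \<open>e\<^bsup>\<sigma> (L + R)\<^esup> X\<close> to \<open>flow \<sigma> X\<close>, and differentiating it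
  replaces \<open>X\<close> by \<open>ad R X\<close>. The claim is therefore Taylor's formula for \<open>V\<close> at \<open>0\<close>. Keeping the factor
  \<open>e\<^bsup>\<sigma> L\<^esup>\<close> inside \<open>V\<close> means that only nonnegative times occur, where the semigroup bounds apply.
\<close>

lemma flow_taylor:
  assumes p: "p > 0" and \<sigma>: "\<sigma> \<in> {0..T}"
  shows "norm (flow \<sigma> X - (\<Sum>j<p. (\<sigma> ^ j / fact j) *\<^sub>R (bexp (\<sigma> *\<^sub>R (L + R)) * (ad R ^^ j) X)))
    \<le> b\<^sub>L * b\<^sub>R * (b\<^sub>R * (2 * r) ^ p) * norm X * \<sigma> ^ p"
proof -
  define V where
    "V j s = bexp (\<sigma> *\<^sub>R L) * bexp ((\<sigma> - s) *\<^sub>R R) * (ad R ^^ j) X * bexp (s *\<^sub>R R)" for j s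
  have V_deriv: "(V j has_vector_derivative V (Suc j) s) (at s within S)" for j s S
  proof -
    have "((\<lambda>s. bexp ((\<sigma> - s) *\<^sub>R R)) has_vector_derivative - 1 *\<^sub>R (R * bexp ((\<sigma> - s) *\<^sub>R R)))
        (at s within S)"
      by (rule bexp_scaleR_has_vector_derivative) (auto intro!: derivative_eq_intros)
    moreover have "((\<lambda>s. bexp (s *\<^sub>R R)) has_vector_derivative R * bexp (s *\<^sub>R R)) (at s within S)"
      by (rule has_vector_derivative_at_within[OF bexp_scaleR_has_vector_derivative_at])
    ultimately have "(V j has_vector_derivative
        bexp (\<sigma> *\<^sub>R L) * bexp ((\<sigma> - s) *\<^sub>R R) * (ad R ^^ j) X * (R * bexp (s *\<^sub>R R)) +
        bexp (\<sigma> *\<^sub>R L) * (- 1 *\<^sub>R (R * bexp ((\<sigma> - s) *\<^sub>R R))) * (ad R ^^ j) X * bexp (s *\<^sub>R R))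
        (at s within S)"
      unfolding V_def by (auto intro!: derivative_eq_intros)
    moreover have "R * (bexp ((\<sigma> - s) *\<^sub>R R) * Y) = bexp ((\<sigma> - s) *\<^sub>R R) * (R * Y)" for Y
      using bexp_scaleR_commute[of R R "\<sigma> - s"] by (simp only: mult.assoc[symmetric])
    ultimately show ?thesis
      by (simp add: V_def ad_def mult.assoc right_diff_distrib left_diff_distrib)
  qed
  let ?i = "\<lambda>s. ((\<sigma> - s) ^ (p - 1) / fact (p - 1)) *\<^sub>R V p s"
  have "(?i has_integral V 0 \<sigma> - (\<Sum>j<p. ((\<sigma> - 0) ^ j / fact j) *\<^sub>R V j 0)) {0..\<sigma>}"
    by (rule Taylor_has_integral[where Df = V, OF p refl V_deriv]) (use \<sigma> in auto)
  moreover have "V 0 \<sigma> = flow \<sigma> X" by (simp add: V_def flow_def)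
  moreover have "V j 0 = bexp (\<sigma> *\<^sub>R (L + R)) * (ad R ^^ j) X" for j
    by (simp add: V_def bexp_scaleR_add)
  ultimately have int: "(?i has_integral flow \<sigma> X -
      (\<Sum>j<p. (\<sigma> ^ j / fact j) *\<^sub>R (bexp (\<sigma> *\<^sub>R (L + R)) * (ad R ^^ j) X))) {0..\<sigma>}"
    by simp
  let ?B = "\<sigma> ^ (p - 1) * (b\<^sub>L * b\<^sub>R * ((2 * r) ^ p * norm X) * b\<^sub>R)"
  have B: "norm (?i s) \<le> ?B" if s: "s \<in> {0..\<sigma>}" for s
  proof -
    have mem: "s \<in> {0..T}" "\<sigma> - s \<in> {0..T}" using s \<sigma> by auto
    have "norm (V p s) \<le> norm (bexp (\<sigma> *\<^sub>R L)) * norm (bexp ((\<sigma> - s) *\<^sub>R R)) *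
        norm ((ad R ^^ p) X) * norm (bexp (s *\<^sub>R R))"
      unfolding V_def
      by (intro order_trans[OF norm_mult_ineq] mult_right_mono norm_mult_ineq norm_ge_zero)
    also have "\<dots> \<le> b\<^sub>L * b\<^sub>R * ((2 * r) ^ p * norm X) * b\<^sub>R"
      by (intro mult_mono norm_bexp_L norm_bexp_R norm_ad_power_le norm_R mem \<sigma>)
        (auto simp: bounds_nonneg)
    finally have V: "norm (V p s) \<le> b\<^sub>L * b\<^sub>R * ((2 * r) ^ p * norm X) * b\<^sub>R" .
    have "(\<sigma> - s) ^ (p - 1) / fact (p - 1) \<le> \<sigma> ^ (p - 1) / 1"
      using s by (intro frac_le power_mono fact_ge_1) auto
    then have "((\<sigma> - s) ^ (p - 1) / fact (p - 1)) * norm (V p s) \<le> ?B"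
      using s V by (intro mult_mono) auto
    then show ?thesis using s by simp
  qed
  have "norm (flow \<sigma> X - (\<Sum>j<p. (\<sigma> ^ j / fact j) *\<^sub>R (bexp (\<sigma> *\<^sub>R (L + R)) * (ad R ^^ j) X)))
      \<le> ?B * (\<sigma> - 0)"
    by (rule norm_has_integral_Icc_le[OF int _ B]) (use \<sigma> in auto)
  also have "\<dots> = b\<^sub>L * b\<^sub>R * (b\<^sub>R * (2 * r) ^ p) * norm X * \<sigma> ^ p"
    using \<sigma> p by (cases p) (auto simp: mult_ac)
  finally show ?thesis .
qed

lemma norm_C_coeff_le:
  assumes h: "h \<in> {0..T}"
  shows "norm (C_coeff m j (h *\<^sub>R (L + R))) \<le> b\<^sub>L * b\<^sub>R"
proof -
  have "norm (C_coeff m j (h *\<^sub>R (L + R))) \<le> (b\<^sub>L * b\<^sub>R) * (1 - 0)"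
  proof (rule norm_has_integral_Icc_le)
    show "((\<lambda>\<theta>. ((1 - \<theta>) ^ j / fact j * newton_weight m \<theta>) *\<^sub>R
        bexp ((1 - \<theta>) *\<^sub>R h *\<^sub>R (L + R))) has_integral C_coeff m j (h *\<^sub>R (L + R))) {0..1}"
      by (rule C_coeff_has_integral)
    fix \<theta> :: real assume \<theta>: "\<theta> \<in> {0..1}"
    have "(1 - \<theta>) ^ j / fact j \<le> 1 / 1"
      using \<theta> by (intro frac_le power_le_one fact_ge_1) auto
    then have w: "(1 - \<theta>) ^ j / fact j * newton_weight m \<theta> \<le> 1 * 1"
      using newton_weight_bounds[OF \<theta>] by (intro mult_mono) auto
    have w0: "0 \<le> (1 - \<theta>) ^ j / fact j * newton_weight m \<theta>"
      using newton_weight_bounds[OF \<theta>] \<theta> by auto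
    have "(1 - \<theta>) * h \<in> {0..T}"
      using \<theta> h mult_mono[of "1 - \<theta>" 1 h T] by auto
    from norm_bexp_add_le[OF this] w w0
    have "(1 - \<theta>) ^ j / fact j * newton_weight m \<theta> * norm (bexp (((1 - \<theta>) * h) *\<^sub>R (L + R)))
        \<le> 1 * (b\<^sub>L * b\<^sub>R)"
      by (intro mult_mono) auto
    then show "norm (((1 - \<theta>) ^ j / fact j * newton_weight m \<theta>) *\<^sub>R
        bexp ((1 - \<theta>) *\<^sub>R h *\<^sub>R (L + R))) \<le> b\<^sub>L * b\<^sub>R"
      by (simp only: norm_scaleR scaleR_scaleR abs_of_nonneg[OF w0] mult_1)
  qed simp
  then show ?thesis by simp
qed

end

section \<open>The METD increment and its local defect\<close>

text \<open>
  The increment as a linear operator on sequences of values of the nonlinearity, so that exact and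
  numerical values can be inserted alike.
\<close>

definition metd_op ::
  "nat \<Rightarrow> real \<Rightarrow> 'a::{real_normed_algebra, monoid_mult, banach} \<Rightarrow> 'a \<Rightarrow> (nat \<Rightarrow> 'a) \<Rightarrow> nat \<Rightarrow> 'a"
  where
  "metd_op p h L R F n =
    h *\<^sub>R (\<Sum>m\<le>p - 1. \<Sum>j\<le>p - 1 - m.
      h ^ j *\<^sub>R (C_coeff m j (h *\<^sub>R (L + R)) * (ad R ^^ j) (bdiff m F n)))"

lemma metd_increment_eq: "metd_increment p h L R N X n = metd_op p h L R (\<lambda>k. N (X k) (real k * h)) n"
  by (simp add: metd_increment_def metd_op_def)

lemma metd_op_diff:
  "metd_op p h L R F n - metd_op p h L R F' n = metd_op p h L R (\<lambda>k. F k - F' k) n"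
  by (simp add: metd_op_def bdiff_eq_binomial_transform binomial_transform_diff
      linear_diff[OF linear_ad_power] right_diff_distrib scaleR_right_diff_distrib sum_subtractf)

lemma sum_triangle_swap:
  fixes f :: "nat \<Rightarrow> nat \<Rightarrow> 'a::comm_monoid_add"
  assumes "p > 0"
  shows "(\<Sum>m\<le>p - 1. \<Sum>j\<le>p - 1 - m. f m j) = (\<Sum>j<p. \<Sum>m<p - j. f m j)"
proof -
  have "{..p - 1} = {..<p}" "\<And>m. m < p \<Longrightarrow> {..p - 1 - m} = {..<p - m}"
    using assms by auto
  then have "(\<Sum>m\<le>p - 1. \<Sum>j\<le>p - 1 - m. f m j) = (\<Sum>m<p. \<Sum>j<p - m. f m j)"
    by simp
  also have "\<dots> = (\<Sum>m<p. \<Sum>j\<in>{j\<in>{..<p}. m + j < p}. f m j)"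
    by (intro sum.cong) auto
  also have "\<dots> = (\<Sum>j<p. \<Sum>m\<in>{m\<in>{..<p}. m + j < p}. f m j)"
    by (rule sum.swap_restrict) auto
  also have "\<dots> = (\<Sum>j<p. \<Sum>m<p - j. f m j)"
    by (intro sum.cong) auto
  finally show ?thesis .
qed

text \<open>
  Grouping by the power of \<open>ad R\<close> exhibits the interpolant of degree below \<open>p - j\<close> that accompanies
  \<open>ad R ^^ j\<close>.
\<close>

lemma metd_op_has_integral:
  assumes p: "p > 0"
  shows "((\<lambda>\<theta>. h *\<^sub>R (\<Sum>j<p. (((1 - \<theta>) * h) ^ j / fact j) *\<^sub>R
      (bexp (((1 - \<theta>) * h) *\<^sub>R (L + R)) *
        (ad R ^^ j) (\<Sum>m<p - j. newton_weight m \<theta> *\<^sub>R bdiff m F n))))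
    has_integral metd_op p h L R F n) {0..1}"
proof -
  let ?E = "\<lambda>\<theta>. bexp ((1 - \<theta>) *\<^sub>R h *\<^sub>R (L + R))"
  have "((\<lambda>\<theta>. h *\<^sub>R (\<Sum>m\<le>p - 1. \<Sum>j\<le>p - 1 - m.
      h ^ j *\<^sub>R ((((1 - \<theta>) ^ j / fact j * newton_weight m \<theta>) *\<^sub>R ?E \<theta>) * (ad R ^^ j) (bdiff m F n))))
    has_integral metd_op p h L R F n) {0..1}"
    unfolding metd_op_def
    by (intro has_integral_cmul has_integral_sum has_integral_mult_left C_coeff_has_integral) simp_all
  moreover have "(\<Sum>m\<le>p - 1. \<Sum>j\<le>p - 1 - m.
      h ^ j *\<^sub>R ((((1 - \<theta>) ^ j / fact j * newton_weight m \<theta>) *\<^sub>R ?E \<theta>) * (ad R ^^ j) (bdiff m F n)))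
    = (\<Sum>j<p. (((1 - \<theta>) * h) ^ j / fact j) *\<^sub>R (bexp (((1 - \<theta>) * h) *\<^sub>R (L + R)) *
        (ad R ^^ j) (\<Sum>m<p - j. newton_weight m \<theta> *\<^sub>R bdiff m F n)))" for \<theta>
    by (subst sum_triangle_swap[OF p])
      (simp add: linear_sum[OF linear_ad_power] linear_scale[OF linear_ad_power]
        sum_distrib_left scaleR_sum_right power_mult_distrib mult_ac)
  ultimately show ?thesis by simp
qed

context commuting_semigroups
begin

definition lip_const :: "nat \<Rightarrow> real" where
  "lip_const p = (\<Sum>m\<le>p - 1. \<Sum>j\<le>p - 1 - m. T ^ j * (b\<^sub>L * b\<^sub>R * ((2 * r) ^ j * 2 ^ m)))"

lemma lip_const_nonneg: "0 \<le> lip_const p"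
  unfolding lip_const_def using bounds_nonneg T_pos by (intro sum_nonneg) auto

lemma norm_metd_op_le:
  assumes h: "h \<in> {0..T}" and B: "\<And>l. l \<le> p - 1 \<Longrightarrow> norm (F (n - l)) \<le> B"
  shows "norm (metd_op p h L R F n) \<le> h * (lip_const p * B)"
proof -
  have B0: "0 \<le> B" using B[of 0] norm_ge_zero order_trans by blast
  have "norm (\<Sum>m\<le>p - 1. \<Sum>j\<le>p - 1 - m.
      h ^ j *\<^sub>R (C_coeff m j (h *\<^sub>R (L + R)) * (ad R ^^ j) (bdiff m F n)))
    \<le> (\<Sum>m\<le>p - 1. \<Sum>j\<le>p - 1 - m. T ^ j * (b\<^sub>L * b\<^sub>R * ((2 * r) ^ j * (2 ^ m * B))))"
  proof (intro sum_norm_le)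
    fix m j assume m: "m \<in> {..p - 1}"
    have "norm (bdiff m F n) \<le> 2 ^ m * B"
      unfolding bdiff_eq_binomial_transform
      by (rule norm_binomial_transform_le, rule B) (use m in auto)
    then have "norm ((ad R ^^ j) (bdiff m F n)) \<le> (2 * r) ^ j * (2 ^ m * B)"
      using bounds_nonneg by (intro order_trans[OF norm_ad_power_le[OF norm_R]] mult_left_mono) auto
    then have "norm (C_coeff m j (h *\<^sub>R (L + R)) * (ad R ^^ j) (bdiff m F n))
        \<le> b\<^sub>L * b\<^sub>R * ((2 * r) ^ j * (2 ^ m * B))"
      by (intro order_trans[OF norm_mult_ineq] mult_mono norm_C_coeff_le h)
        (auto simp: bounds_nonneg)
    then have "h ^ j * norm (C_coeff m j (h *\<^sub>R (L + R)) * (ad R ^^ j) (bdiff m F n))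
        \<le> T ^ j * (b\<^sub>L * b\<^sub>R * ((2 * r) ^ j * (2 ^ m * B)))"
      using h by (intro mult_mono power_mono) auto
    then show "norm (h ^ j *\<^sub>R (C_coeff m j (h *\<^sub>R (L + R)) * (ad R ^^ j) (bdiff m F n)))
        \<le> T ^ j * (b\<^sub>L * b\<^sub>R * ((2 * r) ^ j * (2 ^ m * B)))"
      using h by simp
  qed
  also have "\<dots> = lip_const p * B"
    unfolding lip_const_def sum_distrib_right by (simp add: mult_ac)
  finally show ?thesis
    unfolding metd_op_def using h by (simp add: mult_left_mono)
qed

text \<open>
  The integrand is the derivative of \<open>\<theta> \<mapsto> flow ((1 - \<theta>) h) (Q (c + \<theta> h))\<close>, in which the linear terms
  of the equation cancel. The variable \<open>\<theta>\<close> is already scaled to \<open>[0, 1]\<close> to match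
  \<open>metd_op_has_integral\<close>.
\<close>

lemma variation_of_constants:
  assumes Q: "\<And>t. t \<in> {0..T} \<Longrightarrow>
      (Q has_vector_derivative L * Q t + Q t * R + g t) (at t within {0..T})"
    and c: "c \<in> {0..T}" and h: "h > 0" "c + h \<in> {0..T}"
  shows "((\<lambda>\<theta>. h *\<^sub>R flow ((1 - \<theta>) * h) (g (c + \<theta> * h)))
    has_integral Q (c + h) - flow h (Q c)) {0..1}"
proof -
  define V where "V \<theta> = flow ((1 - \<theta>) * h) (Q (c + \<theta> * h))" for \<theta>
  have "((\<lambda>\<theta>. h *\<^sub>R flow ((1 - \<theta>) * h) (g (c + \<theta> * h))) has_integral V 1 - V 0) {0..1}"
  proof (rule fundamental_theorem_of_calculus)
    fix \<theta> :: real assume \<theta>: "\<theta> \<in> {0..1}"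
    let ?t = "c + \<theta> * h" and ?s = "(1 - \<theta>) * h"
    have mem: "c + x * h \<in> {0..T}" if "x \<in> {0..1}" for x
    proof -
      have "0 \<le> x * h" "x * h \<le> 1 * h" using that h by (auto intro: mult_right_mono)
      then show ?thesis using c h unfolding atLeastAtMost_iff by linarith
    qed
    have "((\<lambda>\<theta>. c + \<theta> * h) has_vector_derivative h) (at \<theta> within {0..1})"
      by (auto intro!: derivative_eq_intros)
    moreover have "(Q has_vector_derivative L * Q ?t + Q ?t * R + g ?t)
        (at ?t within (\<lambda>\<theta>. c + \<theta> * h) ` {0..1})"
      by (rule has_vector_derivative_within_subset[OF Q[OF mem[OF \<theta>]]]) (use mem in auto)
    ultimately have dQ: "((\<lambda>\<theta>. Q (c + \<theta> * h)) has_vector_derivative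
        h *\<^sub>R (L * Q ?t + Q ?t * R + g ?t)) (at \<theta> within {0..1})"
      using vector_diff_chain_within by (fastforce simp: o_def)
    have dE: "((\<lambda>\<theta>. bexp (((1 - \<theta>) * h) *\<^sub>R A)) has_vector_derivative
        (- h) *\<^sub>R (A * bexp (?s *\<^sub>R A))) (at \<theta> within {0..1})" for A :: 'a
      by (rule bexp_scaleR_has_vector_derivative) (auto intro!: derivative_eq_intros)
    have "(V has_vector_derivative
        bexp (?s *\<^sub>R L) * Q ?t * ((- h) *\<^sub>R (R * bexp (?s *\<^sub>R R))) +
        (bexp (?s *\<^sub>R L) * (h *\<^sub>R (L * Q ?t + Q ?t * R + g ?t)) +
          (- h) *\<^sub>R (L * bexp (?s *\<^sub>R L)) * Q ?t) * bexp (?s *\<^sub>R R)) (at \<theta> within {0..1})"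
      unfolding V_def flow_def
      by (intro has_vector_derivative_mult dE dQ)
    moreover have "L * bexp (?s *\<^sub>R L) = bexp (?s *\<^sub>R L) * L"
      by (simp add: bexp_scaleR_commute)
    ultimately show "(V has_vector_derivative h *\<^sub>R flow ?s (g ?t)) (at \<theta> within {0..1})"
      by (simp add: flow_def mult.assoc distrib_left distrib_right scaleR_right_distrib)
  qed simp
  then show ?thesis by (simp add: V_def)
qed

text \<open>
  The first summand bounds the tail of the commutator series, the sum collects the interpolation
  errors of \<open>newton_backward_error\<close> on \<open>p - j\<close> nodes.
\<close>

definition defect_const :: "nat \<Rightarrow> real \<Rightarrow> real" where
  "defect_const p K = b\<^sub>L * b\<^sub>R * K * (b\<^sub>R * (2 * r) ^ p +
    (\<Sum>j<p. (2 * r) ^ j * ((1 + 2 ^ (p - j)) * real (p - j) ^ (p - j))))"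

text \<open>
  The difference of the two integral representations is estimated pointwise in \<open>\<theta>\<close>. The condition
  \<open>p - 1 \<le> n\<close> guarantees that all interpolation nodes lie in \<open>[0, T]\<close>.
\<close>

lemma local_defect:
  assumes p: "p > 0" and h: "h > 0" and n: "p - 1 \<le> n" "real (n + 1) * h \<le> T"
    and Q: "\<And>t. t \<in> {0..T} \<Longrightarrow>
      (Q has_vector_derivative L * Q t + Q t * R + g t) (at t within {0..T})"
    and Dg_0: "Dg 0 = g"
    and Dg: "\<And>i t. i < p \<Longrightarrow> t \<in> {0..T} \<Longrightarrow>
      (Dg i has_vector_derivative Dg (Suc i) t) (at t within {0..T})"
    and K: "\<And>i t. i \<le> p \<Longrightarrow> t \<in> {0..T} \<Longrightarrow> norm (Dg i t) \<le> K"
  shows "norm (Q (real (n + 1) * h) - flow h (Q (real n * h)) -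
      metd_op p h L R (\<lambda>k. g (real k * h)) n) \<le> h * (defect_const p K * h ^ p)"
proof -
  let ?c = "real n * h"
  let ?I = "\<lambda>k \<theta>. \<Sum>m<k. newton_weight m \<theta> *\<^sub>R bdiff m (\<lambda>k. g (real k * h)) n"
  let ?S = "\<lambda>\<theta>. \<Sum>j<p. (((1 - \<theta>) * h) ^ j / fact j) *\<^sub>R
      (bexp (((1 - \<theta>) * h) *\<^sub>R (L + R)) * (ad R ^^ j) (?I (p - j) \<theta>))"
  have ch: "?c + h = real (n + 1) * h" by (simp add: algebra_simps)
  have c_mem: "?c \<in> {0..T}" "?c + h \<in> {0..T}" and h_le: "h \<le> T"
  proof -
    have "0 \<le> ?c" using h by simp
    moreover have "?c + h \<le> T" using n(2) ch by simp
    ultimately show "?c \<in> {0..T}" "?c + h \<in> {0..T}" "h \<le> T"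
      using h unfolding atLeastAtMost_iff by linarith+
  qed
  have int: "((\<lambda>\<theta>. h *\<^sub>R flow ((1 - \<theta>) * h) (g (?c + \<theta> * h)) - h *\<^sub>R ?S \<theta>) has_integral
      Q (real (n + 1) * h) - flow h (Q ?c) - metd_op p h L R (\<lambda>k. g (real k * h)) n) {0..1}"
    unfolding ch[symmetric]
    by (rule has_integral_diff[OF variation_of_constants[OF Q c_mem(1) h c_mem(2)]
          metd_op_has_integral[OF p]])
  have "norm (h *\<^sub>R flow ((1 - \<theta>) * h) (g (?c + \<theta> * h)) - h *\<^sub>R ?S \<theta>)
      \<le> h * (defect_const p K * h ^ p)" if \<theta>: "\<theta> \<in> {0..1}" for \<theta>
  proof -
    define \<sigma> where "\<sigma> = (1 - \<theta>) * h"
    define X where "X = g (?c + \<theta> * h)"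
    have \<sigma>: "0 \<le> \<sigma>" "\<sigma> \<le> h"
      using \<theta> h mult_right_mono[of "1 - \<theta>" 1 h] by (auto simp: \<sigma>_def)
    then have \<sigma>_mem: "\<sigma> \<in> {0..T}" using h_le by auto
    have "?c + \<theta> * h \<in> {0..T}"
    proof -
      have "0 \<le> \<theta> * h" "\<theta> * h \<le> 1 * h" using \<theta> h by (auto intro: mult_right_mono)
      then show ?thesis using c_mem unfolding atLeastAtMost_iff by linarith
    qed
    from K[of 0, OF _ this] have norm_X: "norm X \<le> K" by (simp add: X_def Dg_0)
    then have K0: "0 \<le> K" by (rule order_trans[OF norm_ge_zero])
    let ?U = "\<lambda>j Y. (\<sigma> ^ j / fact j) *\<^sub>R (bexp (\<sigma> *\<^sub>R (L + R)) * (ad R ^^ j) Y)"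
    have conj: "norm (flow \<sigma> X - (\<Sum>j<p. ?U j X)) \<le> b\<^sub>L * b\<^sub>R * (b\<^sub>R * (2 * r) ^ p) * K * h ^ p"
      using \<sigma> K0 bounds_nonneg
      by (intro order_trans[OF flow_taylor[OF p \<sigma>_mem]] mult_mono power_mono norm_X) auto
    have interp: "norm (X - ?I (p - j) \<theta>) \<le> (1 + 2 ^ (p - j)) * (K * (real (p - j) * h) ^ (p - j))"
      if j: "j < p" for j
    proof -
      let ?J = "{?c - real (p - j - 1) * h..?c + h}"
      have "real (p - j - 1) * h \<le> ?c" using n(1) h by (intro mult_right_mono) auto
      then have J: "?J \<subseteq> {0..T}" using c_mem by auto
      have "bdiff m (\<lambda>k. g (real k * h)) n = binomial_transform m (\<lambda>l. g (?c - real l * h))"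
        if "m < p - j" for m
      proof -
        have "g (real (n - l) * h) = g (?c - real l * h)" if "l \<le> m" for l
          using that \<open>m < p - j\<close> n(1) by (simp add: of_nat_diff algebra_simps)
        then show ?thesis
          unfolding bdiff_eq_binomial_transform binomial_transform_def by (intro sum.cong) auto
      qed
      then have "?I (p - j) \<theta> =
          (\<Sum>m<p - j. newton_weight m \<theta> *\<^sub>R binomial_transform m (\<lambda>l. g (?c - real l * h)))"
        by simp
      moreover have "norm (g (?c + \<theta> * h) -
          (\<Sum>m<p - j. newton_weight m \<theta> *\<^sub>R binomial_transform m (\<lambda>l. g (?c - real l * h))))
          \<le> (1 + 2 ^ (p - j)) * (K * (real (p - j) * h) ^ (p - j))"
      proof (rule newton_backward_error[where Dg = Dg, OF _ h \<theta> refl Dg_0])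
        show "(Dg i has_vector_derivative Dg (Suc i) t) (at t within ?J)"
          if "i < p - j" "t \<in> ?J" for i t
          by (rule has_vector_derivative_within_subset[OF Dg J]) (use that J in auto)
      qed (use j J K in auto)
      ultimately show ?thesis by (simp only: X_def)
    qed
    have ad_part: "norm (\<Sum>j<p. ?U j X - ?U j (?I (p - j) \<theta>)) \<le>
        (\<Sum>j<p. h ^ j * (b\<^sub>L * b\<^sub>R * ((2 * r) ^ j *
          ((1 + 2 ^ (p - j)) * (K * (real (p - j) * h) ^ (p - j))))))"
    proof (rule sum_norm_le)
      fix j assume "j \<in> {..<p}"
      then have j: "j < p" by simp
      let ?Y = "X - ?I (p - j) \<theta>"
      let ?B = "(2 * r) ^ j * ((1 + 2 ^ (p - j)) * (K * (real (p - j) * h) ^ (p - j)))"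
      have "norm ((ad R ^^ j) ?Y) \<le> ?B"
        using bounds_nonneg
        by (intro order_trans[OF norm_ad_power_le[OF norm_R]] mult_left_mono interp j) auto
      then have "norm (bexp (\<sigma> *\<^sub>R (L + R)) * (ad R ^^ j) ?Y) \<le> b\<^sub>L * b\<^sub>R * ?B"
        by (intro order_trans[OF norm_mult_ineq] mult_mono norm_bexp_add_le \<sigma>_mem)
          (auto simp: bounds_nonneg)
      moreover have "\<sigma> ^ j / fact j \<le> h ^ j / 1"
        using \<sigma> by (intro frac_le power_mono fact_ge_1) auto
      ultimately have "(\<sigma> ^ j / fact j) * norm (bexp (\<sigma> *\<^sub>R (L + R)) * (ad R ^^ j) ?Y)
          \<le> h ^ j / 1 * (b\<^sub>L * b\<^sub>R * ?B)"
        using h by (intro mult_mono) auto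
      moreover have "?U j X - ?U j (?I (p - j) \<theta>) = ?U j ?Y"
        by (simp add: linear_diff[OF linear_ad_power] right_diff_distrib scaleR_right_diff_distrib)
      ultimately show "norm (?U j X - ?U j (?I (p - j) \<theta>)) \<le> h ^ j * (b\<^sub>L * b\<^sub>R * ?B)"
        using \<sigma> by (simp only: norm_scaleR) simp
    qed
    \<comment> \<open>the truncated commutator series of the exact value, then interpolation inside each of its terms\<close>
    have split: "flow \<sigma> X - ?S \<theta> = (flow \<sigma> X - (\<Sum>j<p. ?U j X)) + (\<Sum>j<p. ?U j X - ?U j (?I (p - j) \<theta>))"
      by (simp add: sum_subtractf \<sigma>_def)
    have total: "(\<Sum>j<p. h ^ j * (b\<^sub>L * b\<^sub>R * ((2 * r) ^ j *
          ((1 + 2 ^ (p - j)) * (K * (real (p - j) * h) ^ (p - j))))))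
        = (\<Sum>j<p. b\<^sub>L * b\<^sub>R * K * h ^ p * ((2 * r) ^ j * ((1 + 2 ^ (p - j)) * real (p - j) ^ (p - j))))"
    proof (rule sum.cong[OF refl])
      fix j assume "j \<in> {..<p}"
      then have "h ^ p = h ^ j * h ^ (p - j)" by (simp add: power_add[symmetric])
      then show "h ^ j * (b\<^sub>L * b\<^sub>R * ((2 * r) ^ j *
          ((1 + 2 ^ (p - j)) * (K * (real (p - j) * h) ^ (p - j)))))
        = b\<^sub>L * b\<^sub>R * K * h ^ p * ((2 * r) ^ j * ((1 + 2 ^ (p - j)) * real (p - j) ^ (p - j)))"
        by (simp only: power_mult_distrib mult_ac)
    qed
    have const: "b\<^sub>L * b\<^sub>R * (b\<^sub>R * (2 * r) ^ p) * K * h ^ p + (\<Sum>j<p. b\<^sub>L * b\<^sub>R * K * h ^ p * ((2 * r) ^ j * ((1 + 2 ^ (p - j)) * real (p - j) ^ (p - j))))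
        = defect_const p K * h ^ p"
      unfolding defect_const_def sum_distrib_left[symmetric] by (simp add: algebra_simps)
    have "norm (flow \<sigma> X - ?S \<theta>) \<le> defect_const p K * h ^ p"
      using norm_triangle_mono[OF conj ad_part] unfolding split[symmetric] total const .
    then have "h * norm (flow \<sigma> X - ?S \<theta>) \<le> h * (defect_const p K * h ^ p)"
      using h by (intro mult_left_mono) auto
    then show ?thesis
      using h by (simp add: scaleR_right_diff_distrib[symmetric] \<sigma>_def X_def)
  qed
  then have "norm (Q (real (n + 1) * h) - flow h (Q ?c) - metd_op p h L R (\<lambda>k. g (real k * h)) n)
      \<le> h * (defect_const p K * h ^ p) * (1 - 0)"
    by (rule norm_has_integral_Icc_le[OF int, rotated]) simp_all
  then show ?thesis by simp
qed

end

section \<open>Propagation of the error\<close>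

context commuting_semigroups
begin

text \<open>
  Each perturbation is transported to the final time by a single application of \<open>flow\<close>, whose norm
  is bounded on \<open>[0, T]\<close> independently of the number of steps.
\<close>

lemma discrete_duhamel:
  assumes "a \<le> n" and rec: "\<And>k. a \<le> k \<Longrightarrow> k < n \<Longrightarrow> e (Suc k) = flow h (e k) + d k"
  shows "e n = flow (real (n - a) * h) (e a) + (\<Sum>k\<in>{a..<n}. flow (real (n - Suc k) * h) (d k))"
  using assms
proof (induction n rule: dec_induct)
  case (step n)
  have shift: "flow h (flow (real i * h) Y) = flow (real (Suc i) * h) Y" for i Y
    by (simp add: flow_flow algebra_simps)
  have "e (Suc n) = flow h (e n) + d n" using step by simp
  also have "e n = flow (real (n - a) * h) (e a) + (\<Sum>k\<in>{a..<n}. flow (real (n - Suc k) * h) (d k))"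
    using step by simp
  also have "flow h \<dots> = flow (real (Suc (n - a)) * h) (e a) +
      (\<Sum>k\<in>{a..<n}. flow (real (Suc (n - Suc k)) * h) (d k))"
    by (simp only: linear_add[OF linear_flow] linear_sum[OF linear_flow] shift)
  also have "\<dots> + d n = flow (real (Suc n - a) * h) (e a) +
      (\<Sum>k\<in>{a..<Suc n}. flow (real (Suc n - Suc k) * h) (d k))"
    using step.hyps by (simp add: Suc_diff_le Suc_diff_Suc del: of_nat_Suc)
  finally show ?case .
qed simp

text \<open>
  The first factor bounds the starting errors and the accumulated defects, the exponential is the
  Gronwall factor.
\<close>

definition error_const :: "nat \<Rightarrow> real \<Rightarrow> real \<Rightarrow> real \<Rightarrow> real" where
  "error_const p C\<^sub>0 L\<^sub>N K = (C\<^sub>0 + b\<^sub>L * b\<^sub>R * (C\<^sub>0 + T * defect_const p K)) *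
    exp (b\<^sub>L * b\<^sub>R * lip_const p * L\<^sub>N * T)"

text \<open>
  The induction carries the growing bound \<open>y n = c h\<^sup>p (1 + q h)\<^sup>n\<close>. It is chosen so that the Gronwall
  step closes exactly: \<open>q h\<close> times the sum of the powers \<open>(1 + q h)\<^sup>k\<close> over \<open>k < n\<close> is
  \<open>(1 + q h)\<^sup>n - 1\<close>. The hypothesis \<open>strip\<close> keeps the earlier values within distance \<open>\<rho>\<close> of the exact
  solution, where the Lipschitz estimate is available.
\<close>

lemma global_error:
  assumes p: "p > 0" and M: "p \<le> M" and h: "h = T / real M"
    and Q: "\<And>t. t \<in> {0..T} \<Longrightarrow>
      (Q has_vector_derivative L * Q t + Q t * R + N (Q t) t) (at t within {0..T})"
    and Dg_0: "Dg 0 = (\<lambda>t. N (Q t) t)"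
    and Dg: "\<And>i t. i < p \<Longrightarrow> t \<in> {0..T} \<Longrightarrow>
      (Dg i has_vector_derivative Dg (Suc i) t) (at t within {0..T})"
    and K: "\<And>i t. i \<le> p \<Longrightarrow> t \<in> {0..T} \<Longrightarrow> norm (Dg i t) \<le> K"
    and lip: "\<And>t X. t \<in> {0..T} \<Longrightarrow> norm (X - Q t) \<le> \<rho> \<Longrightarrow>
      norm (N (Q t) t - N X t) \<le> L\<^sub>N * norm (Q t - X)"
    and L\<^sub>N: "L\<^sub>N \<ge> 0" and C\<^sub>0: "C\<^sub>0 \<ge> 0"
    and scheme: "metd_scheme p h M L R N X"
    and start: "\<And>n. n \<le> p - 1 \<Longrightarrow> norm (Q (real n * h) - X n) \<le> C\<^sub>0 * h ^ p"
    and strip: "error_const p C\<^sub>0 L\<^sub>N K * h ^ p \<le> \<rho>"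
    and n: "n \<le> M"
  shows "norm (Q (real n * h) - X n) \<le> error_const p C\<^sub>0 L\<^sub>N K * h ^ p"
proof -
  let ?b = "b\<^sub>L * b\<^sub>R" and ?D = "defect_const p K" and ?\<Lambda> = "lip_const p"
  define e where "e n = Q (real n * h) - X n" for n
  define c where "c = C\<^sub>0 + ?b * (C\<^sub>0 + T * ?D)"
  define q where "q = ?b * ?\<Lambda> * L\<^sub>N"
  define y where "y n = c * h ^ p * (1 + q * h) ^ n" for n
  have h_pos: "h > 0" and Mh: "real M * h = T" using h T_pos M p by auto
  have time: "0 \<le> real k * h" "real k * h \<le> T" if "k \<le> M" for k
    using that h_pos mult_right_mono[of "real k" "real M" h] Mh by auto
  have h_le: "h \<le> T" using time[of 1] M p by simp
  have "0 \<le> K" by (rule order_trans[OF norm_ge_zero K[of 0 0]]) (use T_pos in auto)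
  then have D0: "0 \<le> ?D"
    unfolding defect_const_def using bounds_nonneg
    by (intro mult_nonneg_nonneg add_nonneg_nonneg sum_nonneg) auto
  have b0: "0 \<le> ?b" by (simp add: bounds_nonneg)
  have q0: "0 \<le> q" unfolding q_def using b0 lip_const_nonneg L\<^sub>N by simp
  have c0: "C\<^sub>0 \<le> c" "0 \<le> c" unfolding c_def using b0 C\<^sub>0 D0 T_pos by auto
  have y_mono: "y i \<le> y k" if "i \<le> k" for i k
    unfolding y_def using that c0 q0 h_pos by (intro mult_left_mono power_increasing) auto
  have y_le: "y k \<le> error_const p C\<^sub>0 L\<^sub>N K * h ^ p" if "k \<le> M" for k
  proof -
    have "(1 + q * h) ^ k \<le> exp (q * h) ^ k"
      using q0 h_pos by (intro power_mono exp_ge_add_one_self) auto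
    also have "\<dots> = exp (q * (real k * h))" by (simp add: exp_of_nat_mult[symmetric] mult_ac)
    also have "\<dots> \<le> exp (q * T)" using q0 time[OF that] by (simp add: mult_left_mono)
    finally have "c * h ^ p * (1 + q * h) ^ k \<le> c * h ^ p * exp (q * T)"
      using c0 h_pos by (intro mult_left_mono) auto
    then show ?thesis by (simp add: y_def error_const_def c_def q_def mult_ac)
  qed
  have geometric: "q * h * (\<Sum>k<n. (1 + q * h) ^ k) = (1 + q * h) ^ n - 1" for n
    by (induction n) (simp_all add: algebra_simps)
  have "norm (e n) \<le> y n" if "n \<le> M" for n
    using that
  proof (induction n rule: less_induct)
    case (less n)
    show ?case
    proof (cases "n \<le> p - 1")
      case True
      have "norm (e n) \<le> C\<^sub>0 * h ^ p" using start[OF True] by (simp add: e_def)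
      also have "\<dots> \<le> y 0" using c0 h_pos by (simp add: y_def mult_right_mono)
      also have "\<dots> \<le> y n" by (rule y_mono) simp
      finally show ?thesis .
    next
      case False
      define F where "F k = N (Q (real k * h)) (real k * h)" for k
      define F' where "F' k = N (X k) (real k * h)" for k
      \<comment> \<open>local defect plus the effect of inserting numerical instead of exact values into the increment\<close>
      define d where "d k = (Q (real (k + 1) * h) - flow h (Q (real k * h)) - metd_op p h L R F k) +
          (metd_op p h L R F k - metd_op p h L R F' k)" for k
      have e_Suc: "e (Suc k) = flow h (e k) + d k" if k: "p - 1 \<le> k" "k < n" for k
      proof -
        have "X (k + 1) = flow h (X k) + metd_op p h L R F' k"
          using scheme k less.prems
          by (simp add: metd_scheme_def metd_increment_eq flow_def F'_def[abs_def])
        then show ?thesis by (simp add: e_def d_def linear_diff[OF linear_flow])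
      qed
      have norm_d: "norm (d k) \<le> h * (?D * h ^ p) + h * (?\<Lambda> * (L\<^sub>N * y k))"
        if k: "p - 1 \<le> k" "k < n" for k
        unfolding d_def
      proof (rule norm_triangle_mono)
        show "norm (Q (real (k + 1) * h) - flow h (Q (real k * h)) - metd_op p h L R F k)
            \<le> h * (?D * h ^ p)"
          unfolding F_def
          by (rule local_defect[where Dg = Dg, OF p h_pos k(1) _ Q Dg_0 Dg K]) (use time[of "k + 1"] k less.prems in auto)
        show "norm (metd_op p h L R F k - metd_op p h L R F' k) \<le> h * (?\<Lambda> * (L\<^sub>N * y k))"
          unfolding metd_op_diff
        proof (rule norm_metd_op_le)
          show "h \<in> {0..T}" using h_pos h_le by simp
          fix l assume "l \<le> p - 1"
          have i: "k - l < n" "k - l \<le> M" using k less.prems by auto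
          have "norm (e (k - l)) \<le> y (k - l)" by (rule less.IH[OF i])
          moreover have "y (k - l) \<le> \<rho>" using y_le[OF i(2)] strip by linarith
          ultimately have "norm (F (k - l) - F' (k - l)) \<le> L\<^sub>N * norm (e (k - l))"
            unfolding F_def F'_def e_def
            by (intro lip) (use time[OF i(2)] in \<open>auto simp: norm_minus_commute\<close>)
          also have "\<dots> \<le> L\<^sub>N * y k"
            using less.IH[OF i] y_mono[of "k - l" k] L\<^sub>N by (intro mult_left_mono) auto
          finally show "norm (F (k - l) - F' (k - l)) \<le> L\<^sub>N * y k" .
        qed
      qed
      let ?a = "p - 1"
      have norm_flow: "norm (flow (real k * h) Y) \<le> ?b * norm Y" if "k \<le> M" for k Y
        by (rule norm_flow_le) (use time[OF that] in auto)
      let ?\<beta> = "\<lambda>k. ?b * (h * (?D * h ^ p) + h * (?\<Lambda> * (L\<^sub>N * y k)))"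
      have accumulated: "(\<Sum>k\<in>{?a..<n}. ?\<beta> k) \<le>
          ?b * (T * (?D * h ^ p)) + c * h ^ p * ((1 + q * h) ^ n - 1)"
      proof -
        have "0 \<le> y k" for k unfolding y_def using c0 q0 h_pos by simp
        then have "0 \<le> ?\<beta> k" for k
          using b0 D0 h_pos lip_const_nonneg L\<^sub>N by simp
        then have "(\<Sum>k\<in>{?a..<n}. ?\<beta> k) \<le> (\<Sum>k<n. ?\<beta> k)"
          by (intro sum_mono2) auto
        also have "\<dots> = ?b * ((real n * h) * (?D * h ^ p)) +
            c * h ^ p * (q * h * (\<Sum>k<n. (1 + q * h) ^ k))"
          by (simp add: y_def q_def distrib_left sum.distrib sum_distrib_left mult_ac)
        also have "\<dots> \<le> ?b * (T * (?D * h ^ p)) + c * h ^ p * ((1 + q * h) ^ n - 1)"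
          unfolding geometric using time[OF less.prems] b0 D0 h_pos
          by (intro add_right_mono mult_left_mono mult_right_mono) auto
        finally show ?thesis .
      qed
      have e_n: "e n = flow (real (n - ?a) * h) (e ?a) +
          (\<Sum>k\<in>{?a..<n}. flow (real (n - Suc k) * h) (d k))"
        by (rule discrete_duhamel[where e = e and d = d]) (use False in simp, fact e_Suc)
      have "norm (e n) \<le> ?b * (C\<^sub>0 * h ^ p) + (\<Sum>k\<in>{?a..<n}. ?\<beta> k)"
        unfolding e_n
      proof (intro norm_triangle_mono sum_norm_le)
        show "norm (flow (real (n - ?a) * h) (e ?a)) \<le> ?b * (C\<^sub>0 * h ^ p)"
          using start[of ?a] b0 less.prems
          by (intro order_trans[OF norm_flow] mult_left_mono) (auto simp: e_def)
        show "norm (flow (real (n - Suc k) * h) (d k)) \<le> ?\<beta> k" if "k \<in> {?a..<n}" for k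
          using that b0 less.prems norm_d[of k]
          by (intro order_trans[OF norm_flow] mult_left_mono) auto
      qed
      also have "\<dots> \<le> ?b * (C\<^sub>0 * h ^ p) +
          (?b * (T * (?D * h ^ p)) + c * h ^ p * ((1 + q * h) ^ n - 1))"
        by (rule add_left_mono[OF accumulated])
      also have "\<dots> = (?b * (C\<^sub>0 + T * ?D) - c) * h ^ p + y n"
        by (simp add: y_def algebra_simps)
      also have "\<dots> \<le> y n" using C\<^sub>0 h_pos by (simp add: c_def)
      finally show ?thesis .
    qed
  qed
  from this[OF n] y_le[OF n] show ?thesis by (simp add: e_def)
qed

end

theorem theorem2:
  fixes p :: nat and T C\<^sub>L \<omega>\<^sub>L C\<^sub>R \<omega>\<^sub>R r L\<^sub>N K C\<^sub>0 :: real
  assumes "p \<ge> 1" and "T > 0"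
    and "C\<^sub>L > 0" and "C\<^sub>R > 0" and "L\<^sub>N \<ge> 0" and "C\<^sub>0 \<ge> 0"
  shows "\<exists>C>0. \<forall>(L :: 'a::{real_normed_algebra, monoid_mult, banach}) R N Q Q\<^sub>0 \<rho>.
    L * R - R * L = 0 \<longrightarrow>
    Q 0 = Q\<^sub>0 \<longrightarrow>
    (\<forall>t\<in>{0..T}. (Q has_vector_derivative (L * Q t + Q t * R + N (Q t) t)) (at t within {0..T})) \<longrightarrow>
    generates_analytic_semigroup L \<longrightarrow>
    generates_analytic_semigroup R \<longrightarrow>
    generates_analytic_semigroup (L + R) \<longrightarrow>
    (\<forall>t\<ge>0. norm (bexp (t *\<^sub>R L)) \<le> C\<^sub>L * exp (\<omega>\<^sub>L * t)) \<longrightarrow>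
    (\<forall>t\<ge>0. norm (bexp (t *\<^sub>R R)) \<le> C\<^sub>R * exp (\<omega>\<^sub>R * t)) \<longrightarrow>
    (\<exists>C'>0. \<exists>\<omega>. \<forall>t\<ge>0. norm (bexp (t *\<^sub>R (L + R))) \<le> C' * exp (\<omega> * t)) \<longrightarrow>
    norm R \<le> r \<longrightarrow>
    \<rho> > 0 \<longrightarrow>
    (\<forall>t\<in>{0..T}. \<forall>X Y. norm (X - Q t) \<le> \<rho> \<longrightarrow> norm (Y - Q t) \<le> \<rho> \<longrightarrow>
      norm (N X t - N Y t) \<le> L\<^sub>N * norm (X - Y)) \<longrightarrow>
    C_k_on p (\<lambda>t. N (Q t) t) {0..T} \<longrightarrow>
    (\<forall>i\<le>p. \<forall>t\<in>{0..T}. norm (iter_deriv_on {0..T} i (\<lambda>t. N (Q t) t) t) \<le> K) \<longrightarrow>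
    (\<exists>h\<^sub>0>0. \<forall>M h X. M \<ge> p \<longrightarrow> h = T / real M \<longrightarrow> h \<le> h\<^sub>0 \<longrightarrow>
      metd_scheme p h M L R N X \<longrightarrow>
      (MAX n\<in>{0..p - 1}. norm (Q (real n * h) - X n)) \<le> C\<^sub>0 * h ^ p \<longrightarrow>
      (MAX n\<in>{0..M}. norm (Q (real n * h) - X n)) \<le> C * h ^ p)"
proof -
  define b\<^sub>L where "b\<^sub>L = C\<^sub>L * exp (\<bar>\<omega>\<^sub>L\<bar> * T)"
  define b\<^sub>R where "b\<^sub>R = C\<^sub>R * exp (\<bar>\<omega>\<^sub>R\<bar> * T)"
  \<comment> \<open>\<open>error_const\<close> is nonnegative only under the hypotheses on the problem, but \<open>C > 0\<close> is claimed beforehand\<close>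
  define C where "C = \<bar>commuting_semigroups.error_const T b\<^sub>L b\<^sub>R r p C\<^sub>0 L\<^sub>N K\<bar> + 1"
  have bound: "c * exp (\<omega> * t) \<le> c * exp (\<bar>\<omega>\<bar> * T)" if "t \<in> {0..T}" "c > 0" for c \<omega> t :: real
  proof -
    have "\<omega> * t \<le> \<bar>\<omega>\<bar> * T" using that by (intro mult_mono) auto
    then show ?thesis using that by simp
  qed
  show ?thesis
  proof (rule exI[of _ C], intro conjI allI impI)
    show "C > 0" by (simp add: C_def)
    fix L R :: 'a and N Q Q\<^sub>0 \<rho>
    assume comm: "L * R - R * L = 0"
      and Q: "\<forall>t\<in>{0..T}. (Q has_vector_derivative (L * Q t + Q t * R + N (Q t) t)) (at t within {0..T})"
      and L: "\<forall>t\<ge>0. norm (bexp (t *\<^sub>R L)) \<le> C\<^sub>L * exp (\<omega>\<^sub>L * t)"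
      and R: "\<forall>t\<ge>0. norm (bexp (t *\<^sub>R R)) \<le> C\<^sub>R * exp (\<omega>\<^sub>R * t)"
      and r: "norm R \<le> r" and \<rho>: "\<rho> > 0"
      and lip: "\<forall>t\<in>{0..T}. \<forall>X Y. norm (X - Q t) \<le> \<rho> \<longrightarrow> norm (Y - Q t) \<le> \<rho> \<longrightarrow>
        norm (N X t - N Y t) \<le> L\<^sub>N * norm (X - Y)"
      and Ck: "C_k_on p (\<lambda>t. N (Q t) t) {0..T}"
      and K: "\<forall>i\<le>p. \<forall>t\<in>{0..T}. norm (iter_deriv_on {0..T} i (\<lambda>t. N (Q t) t) t) \<le> K"
    interpret commuting_semigroups L R T b\<^sub>L b\<^sub>R r
    proof
      show "L * R = R * L" using comm by simp
      show "norm (bexp (t *\<^sub>R L)) \<le> b\<^sub>L" if "t \<in> {0..T}" for t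
        using L bound[OF that \<open>C\<^sub>L > 0\<close>, of \<omega>\<^sub>L] that unfolding b\<^sub>L_def by force
      show "norm (bexp (t *\<^sub>R R)) \<le> b\<^sub>R" if "t \<in> {0..T}" for t
        using R bound[OF that \<open>C\<^sub>R > 0\<close>, of \<omega>\<^sub>R] that unfolding b\<^sub>R_def by force
    qed (use r \<open>T > 0\<close> in auto)
    have C: "error_const p C\<^sub>0 L\<^sub>N K \<le> C" by (simp add: C_def)
    define Dg where "Dg i = iter_deriv_on {0..T} i (\<lambda>t. N (Q t) t)" for i
    have Dg_0: "Dg 0 = (\<lambda>t. N (Q t) t)" by (simp add: Dg_def iter_deriv_on_def)
    have Dg_Suc: "Dg (Suc i) t = vector_derivative (Dg i) (at t within {0..T})" for i t
      by (simp add: Dg_def iter_deriv_on_def)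
    have Dg: "(Dg i has_vector_derivative Dg (Suc i) t) (at t within {0..T})"
      if "i < p" "t \<in> {0..T}" for i t
      using Ck that unfolding Dg_Suc vector_derivative_works[symmetric]
      by (simp add: C_k_on_def Dg_def)
    have K': "norm (Dg i t) \<le> K" if "i \<le> p" "t \<in> {0..T}" for i t
      using K that by (simp add: Dg_def)
    show "\<exists>h\<^sub>0>0. \<forall>M h X. M \<ge> p \<longrightarrow> h = T / real M \<longrightarrow> h \<le> h\<^sub>0 \<longrightarrow>
      metd_scheme p h M L R N X \<longrightarrow>
      (MAX n\<in>{0..p - 1}. norm (Q (real n * h) - X n)) \<le> C\<^sub>0 * h ^ p \<longrightarrow>
      (MAX n\<in>{0..M}. norm (Q (real n * h) - X n)) \<le> C * h ^ p"
    \<comment> \<open>\<open>h \<le> 1\<close> gives \<open>h ^ p \<le> h\<close>, so \<open>h \<le> \<rho> / C\<close> puts the error bound below \<open>\<rho>\<close>\<close>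
    proof (rule exI[of _ "min 1 (\<rho> / C)"], intro conjI allI impI)
      show "min 1 (\<rho> / C) > 0" using \<rho> \<open>C > 0\<close> by simp
      fix M h X
      assume M: "M \<ge> p" and h: "h = T / real M" "h \<le> min 1 (\<rho> / C)"
        and scheme: "metd_scheme p h M L R N X"
        and start: "(MAX n\<in>{0..p - 1}. norm (Q (real n * h) - X n)) \<le> C\<^sub>0 * h ^ p"
      have h0: "h \<ge> 0" using h(1) \<open>T > 0\<close> by simp
      have "h ^ p \<le> h ^ 1" using h0 h(2) \<open>p \<ge> 1\<close> by (intro power_decreasing) auto
      then have "h ^ p \<le> \<rho> / C" using h(2) by simp
      then have "C * h ^ p \<le> \<rho>" using \<open>C > 0\<close> by (simp add: field_simps)
      moreover have le_C: "error_const p C\<^sub>0 L\<^sub>N K * h ^ p \<le> C * h ^ p"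
        using C h0 by (intro mult_right_mono) auto
      ultimately have strip: "error_const p C\<^sub>0 L\<^sub>N K * h ^ p \<le> \<rho>" by linarith
      have start': "norm (Q (real n * h) - X n) \<le> C\<^sub>0 * h ^ p" if "n \<le> p - 1" for n
        by (rule order_trans[OF Max_ge start]) (use that in auto)
      have lip': "norm (N (Q t) t - N X t) \<le> L\<^sub>N * norm (Q t - X)"
        if "t \<in> {0..T}" "norm (X - Q t) \<le> \<rho>" for t X
        using lip that \<rho> by simp
      have "norm (Q (real n * h) - X n) \<le> C * h ^ p" if n: "n \<le> M" for n
      proof (rule order_trans[OF global_error[where Dg = Dg and N = N and X = X and \<rho> = \<rho>] le_C])
        show "p > 0" using \<open>p \<ge> 1\<close> by simp
      qed (fact M h(1) Q[rule_format] Dg_0 Dg K' lip' \<open>L\<^sub>N \<ge> 0\<close> \<open>C\<^sub>0 \<ge> 0\<close> scheme start' strip n)+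
      then show "(MAX n\<in>{0..M}. norm (Q (real n * h) - X n)) \<le> C * h ^ p"
        by (subst Max_le_iff) auto
    qed
  qed
qed

end
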